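(* Let $w$ be a positive integer. Then the class of all (finite) graphs of layered tree-width at most $w$ has asymptotic dimension at most 2.
   Context: All graphs are finite. For a graph $G$ and $x,y\in V(G)$, $d_G(x,y)$ is the minimum number of edges of a path in $G$ between $x$ and $y$. For a nonnegative integer $n$, an $n$-dimensional control function for a class $\mathcal{F}$ of graphs is a function $f:\mathbb{R}^+\to\mathbb{R}^+$ such that for every $G\in\mathcal{F}$ and every real $r>0$ there exist collections $\mathcal{U}_1,\dots,\mathcal{U}_{n+1}$ of subsets of $V(G)$ covering $V(G)$, such that for each $i$, whenever $U\neq U'$ are in $\mathcal{U}_i$ and $x\in U$, $x'\in U'$, we have $d_G(x,x')>r$, and whenever $x,x'$ lie in a common $U\in\mathcal{U}_i$ we have $d_G(x,x')\le f(r)$. The asymptotic dimension of $\mathcal{F}$ is the minimum $n$ for which there is a common $n$-dimensional control function for all graphs in $\mathcal{F}$. A layering of a graph $G$ is an ordered partition $(V_1,V_2,\dots)$ of $V(G)$ into (possibly empty) sets such that for every edge $e$ there is $i_e$ with both ends of $e$ in $V_{i_e}\cup V_{i_e+1}$. The layered tree-width of $G$ is the minimum $w$ such that there exist a tree-decomposition of $G$ and a layering of $G$ such that every bag intersects every layer in at most $w$ vertices. *)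

theory Defs
  imports "Graph_Theory.Graph_Theory" "HOL-Library.Extended_Nat" "HOL-Library.Extended_Real"
begin

text \<open>
  A finite simple graph is a \<^locale>\<open>pair_graph\<close>: a finite, loopless, symmetric digraph in
  which the edge \<open>uv\<close> is the pair of arcs \<open>(u, v)\<close>, \<open>(v, u)\<close>.
\<close>

text \<open>The infimum is \<open>\<infinity>\<close> when no path joins \<open>x\<close> and \<open>y\<close>, and an attained minimum otherwise.\<close>

definition graph_dist :: "'a pair_pre_digraph \<Rightarrow> 'a \<Rightarrow> 'a \<Rightarrow> ereal" where
  "graph_dist G x y =
     (INF p \<in> {p. pre_digraph.apath (with_proj G) x p y}. ereal (real (length p)))"

definition control_function ::
  "nat \<Rightarrow> (real \<Rightarrow> real) \<Rightarrow> 'a pair_pre_digraph set \<Rightarrow> bool" where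
  "control_function n f F \<longleftrightarrow>
     (\<forall>r>0. f r > 0) \<and>
     (\<forall>G\<in>F. \<forall>r>0. \<exists>\<U> :: nat \<Rightarrow> 'a set set.
        (\<forall>i\<in>{1..n+1}. \<forall>U\<in>\<U> i. U \<subseteq> pverts G) \<and>
        (\<Union>i\<in>{1..n+1}. \<Union>(\<U> i)) = pverts G \<and>
        (\<forall>i\<in>{1..n+1}.
           (\<forall>U\<in>\<U> i. \<forall>U'\<in>\<U> i. U \<noteq> U' \<longrightarrow>
              (\<forall>x\<in>U. \<forall>x'\<in>U'. graph_dist G x x' > ereal r)) \<and>
           (\<forall>U\<in>\<U> i. \<forall>x\<in>U. \<forall>x'\<in>U. graph_dist G x x' \<le> ereal (f r))))"

text \<open>In \<^typ>\<open>enat\<close> the infimum of a nonempty set is its minimum, and that of the empty set is \<open>\<infinity>\<close>.\<close>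

definition asymptotic_dimension :: "'a pair_pre_digraph set \<Rightarrow> enat" where
  "asymptotic_dimension F = Inf {enat n | n. \<exists>f. control_function n f F}"

text \<open>
  The library's \<^const>\<open>tree\<close> is not usable here: in a symmetric digraph it counts the closed walk
  \<open>u, v, u\<close> along a single edge as a cycle. In a loopless symmetric digraph the cycles of the
  underlying undirected graph are those of length at least three.
\<close>

definition undirected_tree :: "'a pair_pre_digraph \<Rightarrow> bool" where
  "undirected_tree T \<longleftrightarrow> pair_graph T \<and> Digraph_Component.connected (with_proj T) \<and>
     \<not> (\<exists>p. pre_digraph.cycle (with_proj T) p \<and> length p \<ge> 3)"

definition tree_decomposition ::
  "'a pair_pre_digraph \<Rightarrow> 't pair_pre_digraph \<Rightarrow> ('t \<Rightarrow> 'a set) \<Rightarrow> bool" where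
  "tree_decomposition G T bag \<longleftrightarrow>
     undirected_tree T \<and>
     (\<Union>t\<in>pverts T. bag t) = pverts G \<and>
     (\<forall>(u, v)\<in>parcs G. \<exists>t\<in>pverts T. u \<in> bag t \<and> v \<in> bag t) \<and>
     (\<forall>v\<in>pverts G.
        Digraph_Component.connected (with_proj T \<restriction> {t \<in> pverts T. v \<in> bag t}))"

text \<open>A finite layering is padded with empty layers; the layers are numbered from \<open>0\<close>.\<close>

definition layering :: "'a pair_pre_digraph \<Rightarrow> (nat \<Rightarrow> 'a set) \<Rightarrow> bool" where
  "layering G L \<longleftrightarrow>
     (\<Union>i. L i) = pverts G \<and>
     (\<forall>i j. i \<noteq> j \<longrightarrow> L i \<inter> L j = {}) \<and>
     (\<forall>(u, v)\<in>parcs G. \<exists>i. u \<in> L i \<union> L (Suc i) \<and> v \<in> L i \<union> L (Suc i))"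

text \<open>Every finite tree is isomorphic to one whose nodes are natural numbers.\<close>

definition layered_treewidth :: "'a pair_pre_digraph \<Rightarrow> enat" where
  "layered_treewidth G =
     Inf {enat w | w. \<exists>(T :: nat pair_pre_digraph) bag L.
       tree_decomposition G T bag \<and> layering G L \<and>
       (\<forall>t\<in>pverts T. \<forall>i. card (bag t \<inter> L i) \<le> w)}"

end

(*
A set is "bdd" at scale r if chains in it with jumps of length at most r stay within a bounded
distance of their start; it suffices to find three colour classes with this property.

Graphs of bounded tree-width need only two colours. By induction on the width, colour the bags that
meet a ball Z around the root bag: outside Z they are smaller, and chains near Z are covered by
boundedly many balls. Each subtree hanging below is coloured recursively, starting with a layer that
copies the nearby colours above, followed by a ring of the first and a ring of the second colour.
The rings prevent chains from crossing. A ring lies near boundedly many vertices, so the chains it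
joins were already joined if the bags above were coloured at a sufficiently large scale.

For bounded layered tree-width, slabs of consecutive layers (with their neighbourhoods) have bounded
tree-width. The i-th slab uses the two colours other than i mod 3, so that a chain of one colour
meets at most two consecutive slabs; it stays bounded when the odd slabs are coloured at a scale that
exceeds the bound obtained for the even ones.
*)

theory Submission
  imports Defs
begin

section \<open>Chains of bounded displacement\<close>

text \<open>The reflexive closure lets a walk pause, so the \<open>n\<close>-th power relates points
  at distance at most \<open>n\<close>, not only points joined by a walk of length exactly
  \<open>n\<close>.\<close>

definition near :: "('a \<times> 'a) set \<Rightarrow> nat \<Rightarrow> ('a \<times> 'a) set" where
  "near E n = (E\<^sup>=) ^^ n"

definition nbhd :: "('a \<times> 'a) set \<Rightarrow> nat \<Rightarrow> 'a set \<Rightarrow> 'a set" where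
  "nbhd E n S = near E n `` S"

text \<open>The chain components of \<open>P\<close> at scale \<open>r\<close> lie pairwise more
  than \<open>r\<close> apart, and any two points of one component are within \<open>D\<close>;
  distances are measured in \<open>E\<close>, not inside \<open>P\<close>.\<close>

definition bdd :: "('a \<times> 'a) set \<Rightarrow> nat \<Rightarrow> nat \<Rightarrow> 'a set \<Rightarrow> bool" where
  "bdd E r D P \<longleftrightarrow> (near E r \<inter> P \<times> P)\<^sup>* \<subseteq> near E D"

lemma near_add: "near E m O near E n = near E (m + n)"
  by (simp add: near_def relpow_add)

lemma near_trans: "(x, y) \<in> near E m \<Longrightarrow> (y, z) \<in> near E n \<Longrightarrow> (x, z) \<in> near E (m + n)"
  using near_add by fast

lemma near_refl [simp]: "(x, x) \<in> near E n"
proof (induction n)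
  case (Suc n)
  then show ?case by (auto simp: near_def)
qed (simp add: near_def)

lemma near_mono: "(x, y) \<in> near E m \<Longrightarrow> m \<le> n \<Longrightarrow> (x, y) \<in> near E n"
  using near_trans[OF _ near_refl, of x y E m "n - m"] by simp

lemma near_mono_rel: "E \<subseteq> F \<Longrightarrow> near E n \<subseteq> near F n"
  unfolding near_def by (induction n) auto

lemma near_Suc_D: "(x, z) \<in> near E (Suc n) \<Longrightarrow> \<exists>y. (x = y \<or> (x, y) \<in> E) \<and> (y, z) \<in> near E n"
  unfolding near_def by (blast dest: relpow_Suc_D2)

lemma near_Suc_I: "x = y \<or> (x, y) \<in> E \<Longrightarrow> (y, z) \<in> near E n \<Longrightarrow> (x, z) \<in> near E (Suc n)"
  unfolding near_def by (intro relpow_Suc_I2) auto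

lemma near_sym: "sym E \<Longrightarrow> (x, y) \<in> near E n \<Longrightarrow> (y, x) \<in> near E n"
proof (induction n arbitrary: x)
  case (Suc n)
  then obtain z where z: "x = z \<or> (x, z) \<in> E" "(z, y) \<in> near E n"
    using near_Suc_D by metis
  moreover have "(z, x) \<in> near E 1"
    using z Suc.prems by (auto simp: near_def dest: symD)
  ultimately show ?case
    using Suc near_trans[of y z E n x 1] by simp
qed (simp add: near_def)

text \<open>A walk of length \<open>n\<close> from \<open>x\<close> stays in the
  \<open>n\<close>-ball around \<open>x\<close>, so it survives the deletion of all vertices outside
  \<open>Y\<close>.\<close>

lemma near_restrict:
  assumes "(x, y) \<in> near E n" "nbhd E n {x} \<subseteq> Y"
  shows "(x, y) \<in> near (E \<inter> Y \<times> Y) n"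
  using assms
proof (induction n arbitrary: x)
  case (Suc n)
  obtain z where z: "x = z \<or> (x, z) \<in> E" "(z, y) \<in> near E n"
    using near_Suc_D[OF Suc.prems(1)] by blast
  have "nbhd E n {z} \<subseteq> Y" 
    using Suc.prems(2) near_Suc_I[OF z(1)] unfolding nbhd_def by blast
  moreover have "x \<in> Y" using Suc.prems(2) by (auto simp: nbhd_def)
  moreover have "z \<in> nbhd E n {z}" by (simp add: nbhd_def)
  ultimately show ?case
    using z Suc.IH by (intro near_Suc_I[of x z]) auto
qed (simp add: near_def)

lemma nbhd_mono: "x \<in> nbhd E m S \<Longrightarrow> m \<le> n \<Longrightarrow> S \<subseteq> S' \<Longrightarrow> x \<in> nbhd E n S'"
  unfolding nbhd_def using near_mono by fast

lemma nbhd_self: "S \<subseteq> nbhd E n S"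
  unfolding nbhd_def by (auto intro: near_refl)

lemma nbhd_step: "x \<in> nbhd E m S \<Longrightarrow> (x, y) \<in> near E n \<Longrightarrow> y \<in> nbhd E (m + n) S"
  unfolding nbhd_def using near_trans by fast

lemma bdd_near: "bdd E r D P \<Longrightarrow> (x, y) \<in> (near E r \<inter> P \<times> P)\<^sup>* \<Longrightarrow> (x, y) \<in> near E D"
  unfolding bdd_def by blast

lemma bdd_empty [simp]: "bdd E r D {}"
  by (auto simp: bdd_def)

lemma bdd_diameter:
  assumes "\<And>x y. x \<in> P \<Longrightarrow> y \<in> P \<Longrightarrow> (x, y) \<in> near E D"
  shows "bdd E r D P"
proof -
  have "(x, y) \<in> near E D" if "(x, y) \<in> (near E r \<inter> P \<times> P)\<^sup>*" for x y
  proof (cases "x = y")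
    case False
    then have "x \<in> P" "y \<in> P" using that by (auto elim: converse_rtranclE rtranclE)
    then show ?thesis by (rule assms)
  qed simp
  then show ?thesis unfolding bdd_def by auto
qed

text \<open>Chains of \<open>P\<close> in \<open>E\<close> are chains of \<open>Q\<close> in
  \<open>F\<close>, and walks of \<open>F\<close> are walks of \<open>E\<close>. The last hypothesis
  says that jumps between points of \<open>P\<close> can be made inside the subgraph
  \<open>F\<close>.\<close>

lemma bdd_mono:
  assumes "bdd F r D Q" "P \<subseteq> Q" "F \<subseteq> E" "D \<le> D'"
    "\<And>x y. x \<in> P \<Longrightarrow> y \<in> P \<Longrightarrow> (x, y) \<in> near E r' \<Longrightarrow> (x, y) \<in> near F r"
  shows "bdd E r' D' P"
proof -
  have "(near E r' \<inter> P \<times> P)\<^sup>* \<subseteq> (near F r \<inter> Q \<times> Q)\<^sup>*"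
    using assms by (intro rtrancl_mono) auto
  also have "\<dots> \<subseteq> near F D" using assms(1) by (simp add: bdd_def)
  also have "\<dots> \<subseteq> near E D" by (rule near_mono_rel[OF assms(3)])
  finally show ?thesis using near_mono[OF _ assms(4)] unfolding bdd_def by fast
qed

text \<open>No jump leaves a member of the family, so a chain stays in the member where it
  starts.\<close>

lemma bdd_Union:
  assumes "\<And>K. K \<in> \<K> \<Longrightarrow> bdd E r D K"
    and "\<And>K x y. K \<in> \<K> \<Longrightarrow> x \<in> K \<Longrightarrow> y \<in> \<Union>\<K> \<Longrightarrow> (x, y) \<in> near E r \<Longrightarrow> y \<in> K"
  shows "bdd E r D (\<Union>\<K>)"
proof -
  let ?R = "\<lambda>P. near E r \<inter> P \<times> P"
  have "(x, y) \<in> near E D" if xy: "(x, y) \<in> (?R (\<Union>\<K>))\<^sup>*" for x y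
  proof (cases "x = y")
    case False
    then obtain K where K: "K \<in> \<K>" "x \<in> K"
      using xy by (auto elim: converse_rtranclE)
    have "y \<in> K \<and> (x, y) \<in> (?R K)\<^sup>*"
      using xy
    proof (induction rule: rtrancl_induct)
      case (step y z)
      then have "z \<in> K" using assms(2)[OF K(1)] by blast
      then show ?case using step by (auto intro: rtrancl_into_rtrancl)
    qed (simp add: K)
    then show ?thesis using assms(1)[OF K(1)] bdd_near by metis
  qed simp
  then show ?thesis unfolding bdd_def by auto
qed

text \<open>An excursion of a chain into \<open>B\<close> moves it by at most \<open>M\<close>, so it can be replaced by one
  jump between the points of \<open>A\<close> before and after it.\<close>

lemma bdd_Un:
  assumes B: "bdd E r M B" and A: "bdd E (M + 2 * r) D A"
  shows "bdd E r (D + 2 * M + 2 * r) (A \<union> B)"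
proof -
  let ?R = "near E r \<inter> (A \<union> B) \<times> (A \<union> B)"
  let ?RB = "near E r \<inter> B \<times> B"
  let ?Q = "near E (M + 2 * r) \<inter> A \<times> A"
  \<comment> \<open>Invariant along a chain from \<open>A\<close>: it is at a point of
    \<open>A\<close> reached by long jumps within \<open>A\<close>, or it is on an excursion that
    left \<open>A\<close> at \<open>a\<close> and entered \<open>B\<close> at \<open>b\<close>. A
    return to \<open>A\<close> closes the excursion at cost \<open>r + M + r\<close>, which is one
    long jump.\<close>
  have fromA: "(y \<in> A \<and> (x, y) \<in> ?Q\<^sup>*) \<or>
      (\<exists>a b. (x, a) \<in> ?Q\<^sup>* \<and> a \<in> A \<and> b \<in> B \<and> y \<in> B \<and> (a, b) \<in> near E r \<and> (b, y) \<in> ?RB\<^sup>*)"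
    if "(x, y) \<in> ?R\<^sup>*" "x \<in> A" for x y
    using that(1)
  proof (induction rule: rtrancl_induct)
    case base
    then show ?case using that(2) by simp
  next
    case (step y z)
    consider (A) "y \<in> A" "(x, y) \<in> ?Q\<^sup>*" | (B) a b where "(x, a) \<in> ?Q\<^sup>*" "a \<in> A" "b \<in> B" "y \<in> B"
      "(a, b) \<in> near E r" "(b, y) \<in> ?RB\<^sup>*"
      using step.IH by blast
    then show ?case
    proof cases
      case A
      show ?thesis
      proof (cases "z \<in> A")
        case True
        then have "(y, z) \<in> ?Q" using A step.hyps(2) by (auto intro: near_mono)
        with A(2) have "(x, z) \<in> ?Q\<^sup>*" by (rule rtrancl_into_rtrancl)
        then show ?thesis using True by blast
      next
        case False
        then show ?thesis using A step.hyps(2) by blast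
      qed
    next
      case B
      show ?thesis
      proof (cases "z \<in> A")
        case True
        have "(b, y) \<in> near E M" using B assms(1) bdd_near by metis
        then have "(a, z) \<in> near E (r + M + r)"
          using B(5) step.hyps(2) near_trans by (metis IntD1)
        then have "(a, z) \<in> near E (M + 2 * r)" by (rule near_mono) simp
        then have "(a, z) \<in> ?Q" using B True by blast
        with B(1) have "(x, z) \<in> ?Q\<^sup>*" by (rule rtrancl_into_rtrancl)
        then show ?thesis using True by blast
      next
        case False
        then have "(y, z) \<in> ?RB" using B step.hyps(2) by blast
        with B(6) have "(b, z) \<in> ?RB\<^sup>*" by (rule rtrancl_into_rtrancl)
        then show ?thesis using B(1,2,3,5) False step.hyps(2) by blast
      qed
    qed
  qed
  have A_near: "(x, y) \<in> near E (D + r + M)" if xy: "(x, y) \<in> ?R\<^sup>*" "x \<in> A" for x y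
    using fromA[OF xy]
  proof (elim disjE exE conjE)
    assume "(x, y) \<in> ?Q\<^sup>*"
    from near_mono[OF bdd_near[OF A this]] show ?thesis by simp
  next
    fix a b assume ab: "(x, a) \<in> ?Q\<^sup>*" "(a, b) \<in> near E r" "(b, y) \<in> ?RB\<^sup>*"
    then have "(x, a) \<in> near E D" "(b, y) \<in> near E M"
      using A B bdd_near by metis+
    then show ?thesis using ab(2) near_trans by metis
  qed
  \<comment> \<open>A chain starting in \<open>B\<close> either never visits \<open>A\<close> or has
    a first visit there. The initial stretch costs \<open>M + r\<close>, the remainder
    \<open>D + r + M\<close> by the case of a start in \<open>A\<close>.\<close>
  have fromB: "(x \<in> B \<and> (x, y) \<in> ?RB\<^sup>*) \<or> (\<exists>a b. a \<in> A \<and> (x, b) \<in> ?RB\<^sup>* \<and> (b, a) \<in> near E r \<and> (a, y) \<in> ?R\<^sup>*)"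
    if "(x, y) \<in> ?R\<^sup>*" "x \<in> B" for x y
    using that
  proof (induction rule: converse_rtrancl_induct)
    case (step x z)
    show ?case
    proof (cases "z \<in> A")
      case True
      then show ?thesis using step.hyps by blast
    next
      case False
      then have "(x, z) \<in> ?RB" "z \<in> B" using step by auto
      then show ?thesis
        using step.IH step.prems converse_rtrancl_into_rtrancl[of x z ?RB] by blast
    qed
  qed simp
  have "(x, y) \<in> near E (D + 2 * M + 2 * r)" if xy: "(x, y) \<in> ?R\<^sup>*" for x y
  proof -
    consider "x = y" | "x \<in> A" | "x \<in> B"
      using xy by (auto elim: converse_rtranclE)
    then show ?thesis
    proof cases
      case 2
      then show ?thesis using near_mono[OF A_near[OF xy]] by simp
    next
      case 3
      from fromB[OF xy this] show ?thesis
      proof (elim disjE exE conjE)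
        assume "(x, y) \<in> ?RB\<^sup>*"
        then have "(x, y) \<in> near E M" using B bdd_near by metis
        then show ?thesis by (rule near_mono) simp
      next
        fix a b assume ab: "a \<in> A" "(x, b) \<in> ?RB\<^sup>*" "(b, a) \<in> near E r" "(a, y) \<in> ?R\<^sup>*"
        then have "(x, b) \<in> near E M" "(a, y) \<in> near E (D + r + M)"
          using B bdd_near A_near by metis+
        then have "(x, y) \<in> near E (M + r + (D + r + M))" using ab(3) near_trans by metis
        then show ?thesis by (rule near_mono) simp
      qed
    qed simp
  qed
  then show ?thesis unfolding bdd_def by auto
qed

text \<open>This is the bound of \<open>bdd_Un\<close> iterated: one ball of diameter
  \<open>2 * e\<close> is added to a union of \<open>n\<close> balls that is already
  bounded.\<close>

fun ball_bound :: "nat \<Rightarrow> nat \<Rightarrow> nat \<Rightarrow> nat" where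
  "ball_bound 0 e q = 0"
| "ball_bound (Suc n) e q = 2 * e + 2 * ball_bound n e q + 2 * q"

text \<open>A single ball is bounded by its diameter at every scale, so it can take the role of
  \<open>A\<close> in \<open>bdd_Un\<close>, however large the scale that the remaining balls force.
  The bound depends on the number of centres but not on \<open>E\<close>.\<close>

lemma bdd_balls:
  assumes "sym E" "finite S" "card S \<le> n" "P \<subseteq> nbhd E e S"
  shows "bdd E q (ball_bound n e q) P"
  using assms(2-)
proof (induction n arbitrary: S P)
  case 0
  then have "P = {}" by (simp add: nbhd_def)
  then show ?case by simp
next
  case (Suc n)
  show ?case
  proof (cases "S = {}")
    case True
    then have "P = {}" using Suc.prems by (simp add: nbhd_def)
    then show ?thesis by simp
  next
    case False
    then obtain s where s: "s \<in> S" by blast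
    let ?A = "P \<inter> nbhd E e {s}" and ?B = "P \<inter> nbhd E e (S - {s})"
    have B: "bdd E q (ball_bound n e q) ?B"
      using Suc.prems s by (intro Suc.IH[of "S - {s}"]) auto
    have "(x, y) \<in> near E (2 * e)" if "x \<in> ?A" "y \<in> ?A" for x y
    proof -
      have "(x, s) \<in> near E e" "(s, y) \<in> near E e"
        using that near_sym[OF assms(1)] by (auto simp: nbhd_def)
      from near_trans[OF this] show ?thesis by (simp add: mult_2)
    qed
    then have A: "bdd E q' (2 * e) ?A" for q' by (rule bdd_diameter)
    have "P = ?A \<union> ?B" using Suc.prems(3) by (auto simp: nbhd_def)
    then show ?thesis using bdd_Un[OF B A] by simp
  qed
qed

text \<open>Moving both ends of a jump by at most \<open>a\<close> lengthens it by at most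
  \<open>2 * a\<close>; moving the ends of the whole chain back costs another
  \<open>2 * a\<close>.\<close>

lemma bdd_proj:
  assumes "sym E" "bdd E (q + 2 * a) D P"
    and "\<And>x. x \<in> A \<Longrightarrow> p x \<in> P" "\<And>x. x \<in> A \<Longrightarrow> (p x, x) \<in> near E a"
  shows "bdd E q (D + 2 * a) A"
proof -
  let ?R = "near E q \<inter> A \<times> A" and ?Q = "near E (q + 2 * a) \<inter> P \<times> P"
  have step: "(p x, p y) \<in> ?Q" if "(x, y) \<in> ?R" for x y
  proof -
    have "(p x, x) \<in> near E a" "(x, y) \<in> near E q" "(y, p y) \<in> near E a"
      using that assms near_sym by fast+
    then have "(p x, p y) \<in> near E (a + q + a)" using near_trans by metis
    then have "(p x, p y) \<in> near E (q + 2 * a)" by (rule near_mono) simp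
    then show ?thesis using that assms(3) by blast
  qed
  have "(x, y) \<in> near E (D + 2 * a)" if "(x, y) \<in> ?R\<^sup>*" for x y
  proof (cases "x = y")
    case False
    then have A: "x \<in> A" "y \<in> A" 
      using that by (auto elim: converse_rtranclE rtranclE)
    have "(p x, p y) \<in> ?Q\<^sup>*"
      using that by induction (use step in \<open>auto intro: rtrancl_into_rtrancl\<close>)
    then have "(p x, p y) \<in> near E D" using assms(2) bdd_near by metis
    moreover have "(x, p x) \<in> near E a" "(p y, y) \<in> near E a"
      using A assms near_sym by fast+
    ultimately have "(x, y) \<in> near E (a + D + a)" using near_trans by metis
    then show ?thesis by (rule near_mono) simp
  qed simp
  then show ?thesis unfolding bdd_def by auto
qed

section \<open>Rooted tree-decompositions\<close>

text \<open>Roots are the fixed points of \<open>par\<close>, and several are allowed. The function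
  \<open>dep\<close> makes every climb towards a root terminate.\<close>

locale rooted_tree =
  fixes par :: "'n \<Rightarrow> 'n" and dep :: "'n \<Rightarrow> nat"
  assumes dep_par: "par t = t \<or> dep (par t) < dep t"
begin

definition desc :: "'n \<Rightarrow> 'n set" where
  "desc t = {u. \<exists>n. (par ^^ n) u = t}"

lemma desc_self [simp]: "t \<in> desc t"
  unfolding desc_def by (auto intro: exI[of _ 0])

lemma desc_par:
  assumes "u \<in> desc t" "u \<noteq> t"
  shows "par u \<in> desc t"
proof -
  obtain n where n: "(par ^^ n) u = t" using assms(1) unfolding desc_def by blast
  then obtain m where "n = Suc m" using assms(2) by (cases n) auto
  then have "(par ^^ m) (par u) = t" using n by (simp add: funpow_swap1)
  then show ?thesis unfolding desc_def by blast
qed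

lemma desc_parI:
  assumes "par u \<in> desc t"
  shows "u \<in> desc t"
proof -
  obtain n where "(par ^^ n) (par u) = t" using assms unfolding desc_def by blast
  then have "(par ^^ Suc n) u = t" by (simp add: funpow_swap1)
  then show ?thesis unfolding desc_def by blast
qed

lemma desc_dep: "u \<in> desc t \<Longrightarrow> dep t \<le> dep u"
proof -
  assume "u \<in> desc t"
  then obtain n where "(par ^^ n) u = t" unfolding desc_def by blast
  then show ?thesis
  proof (induction n arbitrary: u)
    case (Suc n)
    then have "dep t \<le> dep (par u)" by (simp add: funpow_swap1)
    then show ?case using dep_par[of u] by auto
  qed simp
qed

lemma desc_dep_strict: "u \<in> desc t \<Longrightarrow> u \<noteq> t \<Longrightarrow> dep t < dep u"
proof -
  assume u: "u \<in> desc t" "u \<noteq> t"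
  then obtain n where "(par ^^ n) u = t" unfolding desc_def by blast
  moreover have "(par ^^ n) u = u" if "par u = u" using that by (induction n) auto
  ultimately have "dep (par u) < dep u" using u(2) dep_par[of u] by auto
  then show ?thesis using desc_dep[OF desc_par[OF u]] by simp
qed

text \<open>Both \<open>s\<close> and \<open>t\<close> are iterates of \<open>par\<close> at
  \<open>u\<close>; the one reached later is an ancestor of the other.\<close>

lemma desc_linear:
  assumes "u \<in> desc s" "u \<in> desc t"
  shows "s \<in> desc t \<or> t \<in> desc s"
proof -
  obtain m n where "(par ^^ m) u = s" "(par ^^ n) u = t"
    using assms unfolding desc_def by blast
  moreover have "(par ^^ (b - a)) ((par ^^ a) u) = (par ^^ b) u" if "a \<le> b" for a b
    using that by (metis funpow_add le_add_diff_inverse2 o_apply)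
  ultimately show ?thesis unfolding desc_def by (metis (mono_tags) mem_Collect_eq nle_le)
qed

lemma par_notin_desc: "par t \<noteq> t \<Longrightarrow> par t \<notin> desc t"
  using desc_dep[of "par t" t] dep_par[of t] by auto

end

text \<open>For \<open>top\<close>: the nodes whose bags contain a given vertex are connected iff all of them but
  the topmost one \<open>m\<close> have their parent among them.\<close>

locale rooted_decomposition = rooted_tree par dep
  for E :: "('a \<times> 'a) set" and par :: "'n \<Rightarrow> 'n" and dep and X :: "'n \<Rightarrow> 'a set" +
  assumes sym: "sym E"
    and edge: "(x, y) \<in> E \<Longrightarrow> \<exists>t. x \<in> X t \<and> y \<in> X t"
    and top: "\<exists>m. \<forall>t. x \<in> X t \<longrightarrow> t \<noteq> m \<longrightarrow> par t \<noteq> t \<and> x \<in> X (par t)"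
begin

text \<open>By \<open>separation\<close>, a vertex of this set occurs in no bag outside the subtree
  of \<open>t\<close>.\<close>

definition below :: "'n \<Rightarrow> 'a set" where
  "below t = (\<Union>u\<in>desc t. X u) - X (par t)"

definition adh :: "'n \<Rightarrow> 'a set" where
  "adh t = X t \<inter> X (par t)"

text \<open>The parent of \<open>\<rho>\<close> is left free, so the descendants within
  \<open>T\<close> of any node of \<open>T\<close> form a subtree again.\<close>

definition subtree :: "'n set \<Rightarrow> 'n \<Rightarrow> bool" where
  "subtree T \<rho> \<longleftrightarrow> finite T \<and> \<rho> \<in> T \<and> (\<forall>t\<in>T - {\<rho>}. par t \<in> T \<and> par t \<noteq> t)"

text \<open>Climbing from \<open>v\<close> while keeping \<open>x\<close> in the bag ends at the
  topmost node \<open>m\<close> without entering the subtree of \<open>t\<close>. The climb from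
  \<open>u\<close> to \<open>m\<close> must therefore leave this subtree, which it can only do from
  \<open>t\<close> to \<open>par t\<close>.\<close>

lemma separation:
  assumes "x \<in> X u" "u \<in> desc t" "x \<in> X v" "v \<notin> desc t"
  shows "x \<in> adh t"
proof -
  obtain m where m: "\<And>t. x \<in> X t \<Longrightarrow> t \<noteq> m \<Longrightarrow> par t \<noteq> t \<and> x \<in> X (par t)"
    using top by blast
  have m_notin: "m \<notin> desc t"
    using assms(3,4)
  proof (induction "dep v" arbitrary: v rule: less_induct)
    case less
    show ?case
    proof (cases "v = m")
      case False
      then have "par v \<noteq> v" "x \<in> X (par v)" using m less.prems by auto
      then show ?thesis using less.hyps[of "par v"] dep_par[of v] desc_parI less.prems by blast
    qed (use less.prems in simp)
  qed
  show ?thesis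
    using assms(1,2)
  proof (induction "dep u" arbitrary: u rule: less_induct)
    case less
    have "u \<noteq> m" using less.prems m_notin by blast
    then have u: "par u \<noteq> u" "x \<in> X (par u)" using m less.prems by auto
    show ?case
    proof (cases "u = t")
      case False
      then show ?thesis using less.hyps[of "par u"] dep_par[of u] desc_par less.prems u by blast
    qed (use less.prems u in \<open>simp add: adh_def\<close>)
  qed
qed

text \<open>A bag containing both ends lies in the subtree of \<open>t\<close>, because
  \<open>x\<close> occurs nowhere else. As \<open>y\<close> is not in \<open>below t\<close>, it
  must lie in the parent bag.\<close>

lemma exit_edge:
  assumes "(x, y) \<in> E" "x \<in> below t" "y \<notin> below t" "par t \<noteq> t"
  shows "y \<in> adh t"
proof -
  obtain v where v: "x \<in> X v" "y \<in> X v" using edge assms(1) by blast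
  have "v \<in> desc t"
  proof (rule ccontr)
    assume "v \<notin> desc t"
    then have "x \<in> adh t" using assms(2) v(1) separation unfolding below_def by blast
    then show False using assms(2) unfolding below_def adh_def by blast
  qed
  then have "y \<in> X (par t)" using v(2) assms(3) unfolding below_def by blast
  then show ?thesis using separation[OF v(2) \<open>v \<in> desc t\<close> _ par_notin_desc] assms(4) by blast
qed

text \<open>The first vertex of the walk outside \<open>below t\<close> lies in the adhesion
  set.\<close>

lemma exit_path:
  assumes "(x, y) \<in> near E n" "x \<in> below t" "y \<notin> below t" "par t \<noteq> t"
  shows "\<exists>s\<in>adh t. (x, s) \<in> near E n \<and> (s, y) \<in> near E n"
  using assms
proof (induction n arbitrary: x)
  case (Suc n)
  then obtain z where z: "x = z \<or> (x, z) \<in> E" "(z, y) \<in> near E n"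
    using near_Suc_D by metis
  show ?case
  proof (cases "z \<in> below t")
    case True
    then obtain s where "s \<in> adh t" "(z, s) \<in> near E n" "(s, y) \<in> near E n"
      using Suc z by blast
    then have "(x, s) \<in> near E (Suc n)" "(s, y) \<in> near E (Suc n)"
      using near_Suc_I[OF z(1)] near_mono[of s y E n "Suc n"] by auto
    then show ?thesis using \<open>s \<in> adh t\<close> by blast
  next
    case False
    then have "(x, z) \<in> E" using z Suc.prems by auto
    then have "z \<in> adh t" using exit_edge False Suc.prems by blast
    moreover have "(x, z) \<in> near E (Suc n)" 
      by (rule near_Suc_I[OF _ near_refl]) (simp add: \<open>(x, z) \<in> E\<close>)
    moreover have "(z, y) \<in> near E (Suc n)" using z(2) by (rule near_mono) simp
    ultimately show ?thesis by blast
  qed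
qed (simp add: near_def)

lemma exit_nbhd:
  assumes "(x, y) \<in> near E n" "x \<in> below t" "y \<notin> below t" "par t \<noteq> t"
  shows "x \<in> nbhd E n (adh t)" "y \<in> nbhd E n (adh t)"
proof -
  obtain s where s: "s \<in> adh t" "(x, s) \<in> near E n" "(s, y) \<in> near E n"
    using exit_path[OF assms] by blast
  show "x \<in> nbhd E n (adh t)" using s(1) near_sym[OF sym s(2)] unfolding nbhd_def by blast
  show "y \<in> nbhd E n (adh t)" using s(1,3) unfolding nbhd_def by blast
qed

lemma restrict: "rooted_decomposition (E \<inter> Y \<times> Y) par dep (\<lambda>t. X t \<inter> Y)"
proof
  show "Relation.sym (E \<inter> Y \<times> Y)" using sym by (auto simp: sym_def)
  show "\<exists>m. \<forall>t. x \<in> X t \<inter> Y \<longrightarrow> t \<noteq> m \<longrightarrow> par t \<noteq> t \<and> x \<in> X (par t) \<inter> Y" for x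
    using top[of x] by blast
qed (use edge in auto)

lemma subtree_root_dep: "subtree T \<rho> \<Longrightarrow> t \<in> T \<Longrightarrow> t \<noteq> \<rho> \<Longrightarrow> dep \<rho> < dep t"
proof (induction "dep t" arbitrary: t rule: less_induct)
  case less
  then have "par t \<in> T" "dep (par t) < dep t" 
    using dep_par[of t] unfolding subtree_def by auto
  then show ?case using less.hyps[of "par t"] less.prems by fastforce
qed

lemma subtree_root_notin: "subtree T \<rho> \<Longrightarrow> t \<in> T \<Longrightarrow> t \<noteq> \<rho> \<Longrightarrow> \<rho> \<notin> desc t"
  using subtree_root_dep desc_dep by (meson leD)

lemma subtree_desc:
  assumes "subtree T \<rho>" "t \<in> T" "t \<noteq> \<rho>"
  shows "subtree (T \<inter> desc t) t" "card (T \<inter> desc t) < card T"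
proof -
  have \<rho>: "\<rho> \<notin> desc t" by (rule subtree_root_notin[OF assms])
  show "subtree (T \<inter> desc t) t"
    using assms desc_par \<rho> unfolding subtree_def by auto
  have "T \<inter> desc t \<subset> T" "finite T" using assms(1) \<rho> unfolding subtree_def by auto
  then show "card (T \<inter> desc t) < card T" by (intro psubset_card_mono)
qed

text \<open>Let \<open>z\<close> be a point of the ball in the bag of \<open>t\<close> but not in
  the parent bag. A shortest way from \<open>z\<close> back to the root bag crosses
  \<open>adh t\<close>, and the crossing point is a point of the ball in the parent bag.\<close>

lemma subtree_ball:
  assumes "subtree T \<rho>"
  shows "subtree (insert \<rho> {t \<in> T. X t \<inter> nbhd E c (X \<rho>) \<noteq> {}}) \<rho>"
proof -
  have "X (par t) \<inter> nbhd E c (X \<rho>) \<noteq> {}"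
    if t: "t \<in> T" "t \<noteq> \<rho>" "z \<in> X t" "z \<in> nbhd E c (X \<rho>)" for t z
  proof (cases "z \<in> X (par t)")
    case False
    then have "z \<in> below t" using t unfolding below_def by (auto intro: bexI[of _ t])
    obtain q where q: "q \<in> X \<rho>" "(q, z) \<in> near E c" using t(4) unfolding nbhd_def by blast
    have "q \<notin> below t"
    proof
      assume "q \<in> below t"
      then obtain u where "u \<in> desc t" "q \<in> X u" "q \<notin> X (par t)" unfolding below_def by blast
      then have "q \<in> adh t" using separation[of q u t \<rho>] q subtree_root_notin[OF assms t(1,2)] by blast
      then show False using \<open>q \<notin> X (par t)\<close> unfolding adh_def by blast
    qed
    moreover have "par t \<noteq> t" using assms t(1,2) unfolding subtree_def by blast
    ultimately obtain s where "s \<in> adh t" "(s, q) \<in> near E c"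
      using exit_path[OF near_sym[OF sym q(2)] \<open>z \<in> below t\<close>] by blast
    then have "s \<in> X (par t) \<inter> nbhd E c (X \<rho>)"
      using q(1) near_sym[OF sym, of s q c] unfolding nbhd_def adh_def by blast
    then show ?thesis by blast
  qed (use t in blast)
  then show ?thesis using assms unfolding subtree_def by auto
qed

end

section \<open>Two colours for bounded tree-width\<close>

text \<open>\<open>S\<close> is the part of the root bag shared with the tree above, whose colours are already
  fixed. Later the colours within distance \<open>r\<close> of \<open>S\<close> are overridden by colours from above; the
  rest of the \<^const>\<open>True\<close> ring stops the chains of colour \<^const>\<open>False\<close> coming from there,
  and the \<^const>\<open>False\<close> ring stops those of colour \<^const>\<open>True\<close>.\<close>

definition extending_colouring ::
  "('a \<times> 'a) set \<Rightarrow> nat \<Rightarrow> nat \<Rightarrow> 'a set \<Rightarrow> 'a set \<Rightarrow> ('a \<Rightarrow> bool) \<Rightarrow> bool" where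
  "extending_colouring E r D V S c \<longleftrightarrow>
     (\<forall>x\<in>V. x \<in> nbhd E (2 * r) S \<longrightarrow> c x) \<and>
     (\<forall>x\<in>V. x \<in> nbhd E (3 * r) S \<longrightarrow> x \<notin> nbhd E (2 * r) S \<longrightarrow> \<not> c x) \<and>
     (\<forall>j. bdd E r D {x \<in> V. x \<notin> nbhd E (2 * r) S \<and> c x = j})"

context rooted_decomposition
begin

text \<open>The bags near the root bag lose a vertex when the ball \<open>Z\<close> is removed, so \<open>\<chi>\<close> comes from
  the induction on the width; the scale \<open>r\<^sub>1\<close> is so large that no two chains of \<open>\<chi>\<close> are merged by
  the rings around the adhesion sets of the subtrees hanging below.\<close>

lemma extend_step:
  fixes r k D\<^sub>1 :: nat and \<chi> :: "'a \<Rightarrow> bool"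
  defines "M \<equiv> ball_bound (Suc k) (2 * r) r"
  defines "r\<^sub>1 \<equiv> M + 4 * r"
  defines "e \<equiv> 3 * r + r\<^sub>1"
  defines "D\<^sub>2 \<equiv> ball_bound (Suc k) e (D\<^sub>1 + 2 * r\<^sub>1) + 2 * D\<^sub>1 + 2 * r\<^sub>1"
  defines "D \<equiv> (D\<^sub>2 + 2 * r) + 2 * M + 2 * r"
  assumes T: "subtree T \<rho>" "\<And>t. t \<in> T \<Longrightarrow> finite (X t)" "\<And>t. t \<in> T \<Longrightarrow> card (X t) \<le> Suc k"
    and S: "S \<subseteq> X \<rho>"
  defines "Z \<equiv> nbhd E (3 * r) (X \<rho>)"
  defines "T\<^sub>0 \<equiv> insert \<rho> {t \<in> T. X t \<inter> Z \<noteq> {}}"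
  assumes \<chi>: "\<And>j. bdd (E \<inter> (- Z) \<times> (- Z)) r\<^sub>1 D\<^sub>1 {x \<in> \<Union>(X ` T\<^sub>0) - Z. \<chi> x = j}"
    and IH: "\<And>t. t \<in> T \<Longrightarrow> t \<noteq> \<rho> \<Longrightarrow>
      \<exists>c. extending_colouring E r D (\<Union>(X ` (T \<inter> desc t))) (adh t) c"
  shows "\<exists>c. extending_colouring E r D (\<Union>(X ` T)) S c"
proof -

  \<comment> \<open>The tree near the root bag and the subtrees hanging below it\<close>
  let ?V = "\<Union>(X ` T)" and ?V\<^sub>0 = "\<Union>(X ` T\<^sub>0)"
  let ?N = "\<lambda>n. nbhd E n"
  have T\<^sub>0: "subtree T\<^sub>0 \<rho>" "T\<^sub>0 \<subseteq> T"
    using subtree_ball[OF T(1)] T(1) unfolding T\<^sub>0_def Z_def subtree_def by auto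
  have V\<^sub>0: "?V\<^sub>0 \<subseteq> ?V" using T\<^sub>0(2) by blast
  have Z_V\<^sub>0: "x \<in> ?V\<^sub>0" if "x \<in> ?V" "x \<in> Z" for x
    using that unfolding T\<^sub>0_def by auto
  \<comment> \<open>These are the topmost nodes outside \<open>T\<^sub>0\<close>, that is, the roots
    of the hanging subtrees.\<close>
  define H where "H = {t \<in> T - T\<^sub>0. par t \<in> T\<^sub>0}"
  have H: "t \<in> T" "t \<noteq> \<rho>" "par t \<noteq> t" "par t \<in> T\<^sub>0" "t \<notin> T\<^sub>0" if "t \<in> H" for t
    using that T\<^sub>0(1) unfolding H_def subtree_def by auto
  have sym_near: "(x, y) \<in> near E n \<longleftrightarrow> (y, x) \<in> near E n" for x y n
    using near_sym[OF sym] by metis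
  have T\<^sub>0_desc: "u \<notin> desc t" if "t \<in> H" "u \<in> T\<^sub>0" for t u
    using that(2)
  proof (induction "dep u" arbitrary: u rule: less_induct)
    case less
    show ?case
    proof
      assume u: "u \<in> desc t"
      then have "u \<noteq> t" "u \<noteq> \<rho>"
        using less.prems H[OF that(1)] subtree_root_notin[OF T(1), of t] by auto
      then have "par u \<in> T\<^sub>0" "par u \<noteq> u" using T\<^sub>0(1) less.prems unfolding subtree_def by auto
      then show False
        using less.hyps[of "par u"] dep_par[of u] desc_par[OF u \<open>u \<noteq> t\<close>] by auto
    qed
  qed
  have V\<^sub>0_below: "x \<notin> below t" if "t \<in> H" "x \<in> ?V\<^sub>0" for t x
  proof
    assume x: "x \<in> below t"
    obtain v where "v \<in> T\<^sub>0" "x \<in> X v" using \<open>x \<in> ?V\<^sub>0\<close> by blast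
    then have "x \<in> adh t"
      using x separation[of x _ t v] T\<^sub>0_desc[OF that(1)] unfolding below_def by blast
    then show False using x unfolding below_def adh_def by blast
  qed
  have adh_V\<^sub>0: "adh t \<subseteq> ?V\<^sub>0" if "t \<in> H" for t
    using H[OF that] unfolding adh_def by blast
  have hang: "\<exists>t\<in>H. x \<in> below t" if x: "x \<in> ?V" "x \<notin> ?V\<^sub>0" for x
  proof -
    have "\<exists>t\<in>H. u \<in> desc t" if "u \<in> T" "u \<notin> T\<^sub>0" for u
      using that
    proof (induction "dep u" arbitrary: u rule: less_induct)
      case less
      have "u \<noteq> \<rho>" using less.prems(2) T\<^sub>0(1) unfolding subtree_def by auto
      then have p: "par u \<in> T" "dep (par u) < dep u"
        using T(1) less.prems dep_par[of u] unfolding subtree_def by auto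
      show ?case
      proof (cases "par u \<in> T\<^sub>0")
        case True
        then show ?thesis using less.prems unfolding H_def by (auto intro: bexI[of _ u])
      next
        case False
        then show ?thesis using less.hyps[OF p(2) p(1)] desc_parI by blast
      qed
    qed
    moreover obtain u where "u \<in> T" "u \<notin> T\<^sub>0" "x \<in> X u" using x by blast
    ultimately obtain t where "t \<in> H" "u \<in> desc t" by blast
    then show ?thesis using \<open>x \<in> X u\<close> x(2) H(4)[of t] unfolding below_def by blast
  qed
  have hang_unique: "s = t" if st: "s \<in> H" "t \<in> H" "x \<in> below s" "x \<in> below t" for s t x
  proof (rule ccontr)
    assume "s \<noteq> t"
    \<comment> \<open>A common descendant makes \<open>s\<close> and \<open>t\<close> comparable;
      then the parent of one of them, a node of \<open>T\<^sub>0\<close>, would descend from the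
      other.\<close>
    have disj: False if u: "u \<in> desc s" "u \<in> desc t" for u
    proof -
      consider "s \<in> desc t" | "t \<in> desc s" using desc_linear[OF u] by blast
      then show False
      proof cases
        case 1
        then show False using desc_par[of s t] \<open>s \<noteq> t\<close> T\<^sub>0_desc[OF st(2) H(4)[OF st(1)]] by blast
      next
        case 2
        then show False using desc_par[of t s] \<open>s \<noteq> t\<close> T\<^sub>0_desc[OF st(1) H(4)[OF st(2)]] by blast
      qed
    qed
    obtain u v where uv: "u \<in> desc s" "x \<in> X u" "v \<in> desc t" "x \<in> X v"
      using st unfolding below_def by blast
    then have "x \<in> adh s" using separation[of x u s v] disj by blast
    then show False using st(3) unfolding below_def adh_def by blast
  qed
  have V_below: "x \<in> \<Union>(X ` (T \<inter> desc t))" if "x \<in> ?V" "x \<in> below t" for x t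
  proof -
    obtain u where u: "u \<in> T" "x \<in> X u" using \<open>x \<in> ?V\<close> by blast
    have "u \<in> desc t"
    proof (rule ccontr)
      assume "u \<notin> desc t"
      then have "x \<in> adh t" using that(2) separation[of x _ t u] u unfolding below_def by blast
      then show False using that(2) unfolding below_def adh_def by blast
    qed
    then show ?thesis using u by blast
  qed
  have exit: "x \<in> ?N n (adh t)" if "(x, y) \<in> near E n" "t \<in> H" "x \<in> below t" "y \<notin> below t" for x y n t
    using exit_nbhd(1)[OF that(1,3,4) H(3)[OF that(2)]] .

  \<comment> \<open>Colouring of the vertices near the root bag\<close>
  define g where "g x \<longleftrightarrow> x \<in> ?N (2 * r) S \<or> (x \<notin> ?N e (X \<rho>) \<and> \<chi> x)" for x
  \<comment> \<open>Within distance \<open>e\<close> of the root bag, \<open>g\<close> is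
    \<open>False\<close> except on the first ring around \<open>S\<close>, which supplies the second
    ring. This region is covered by at most \<open>Suc k\<close> balls, so it can be added to the
    classes of \<open>\<chi>\<close> by \<open>bdd_Un\<close> whatever its colours are.\<close>
  have g: "bdd E r\<^sub>1 D\<^sub>2 {x \<in> ?V\<^sub>0. x \<notin> ?N (2 * r) S \<and> g x = j}" for j
  proof -
    let ?W = "{x \<in> ?V\<^sub>0. x \<notin> ?N e (X \<rho>) \<and> \<chi> x = j}"
    let ?Y = "?N e (X \<rho>)"
    have eZ: "x \<notin> Z" if "x \<notin> ?Y" for x
      using that nbhd_mono[of x E "3 * r" "X \<rho>" e "X \<rho>"] unfolding Z_def e_def by auto
    have W: "bdd E r\<^sub>1 D\<^sub>1 ?W"
    proof (rule bdd_mono[OF \<chi>[of j]])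
      show "?W \<subseteq> {x \<in> ?V\<^sub>0 - Z. \<chi> x = j}" using eZ by blast
      show "(x, y) \<in> near (E \<inter> (- Z) \<times> (- Z)) r\<^sub>1" if "x \<in> ?W" "(x, y) \<in> near E r\<^sub>1" for x y
      proof (rule near_restrict[OF that(2)])
        have "x \<in> ?Y" if "(x, z) \<in> near E r\<^sub>1" "z \<in> Z" for z
          using nbhd_step[of z E "3 * r" "X \<rho>" x r\<^sub>1] that sym_near unfolding Z_def e_def by blast
        then show "nbhd E r\<^sub>1 {x} \<subseteq> - Z" using that(1) unfolding nbhd_def by blast
      qed
    qed auto
    have "\<rho> \<in> T" using T(1) unfolding subtree_def by blast
    then have Y: "bdd E (D\<^sub>1 + 2 * r\<^sub>1) (ball_bound (Suc k) e (D\<^sub>1 + 2 * r\<^sub>1)) ?Y"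
      using T(2,3)[of \<rho>] by (intro bdd_balls[OF sym, of "X \<rho>"]) auto
    show ?thesis
    proof (rule bdd_mono[OF bdd_Un[OF W Y]])
      show "{x \<in> ?V\<^sub>0. x \<notin> ?N (2 * r) S \<and> g x = j} \<subseteq> ?Y \<union> ?W"
        unfolding g_def by blast
    qed (auto simp: D\<^sub>2_def)
  qed

  \<comment> \<open>Gluing with the colourings of the hanging subtrees\<close>
  have "\<exists>C. \<forall>t\<in>H. extending_colouring E r D (\<Union>(X ` (T \<inter> desc t))) (adh t) (C t)"
    using IH H(1,2) by (intro bchoice) blast
  then obtain C where C: "\<And>t. t \<in> H \<Longrightarrow>
      extending_colouring E r D (\<Union>(X ` (T \<inter> desc t))) (adh t) (C t)"
    by blast
  define h where "h x = (SOME t. t \<in> H \<and> x \<in> below t)" for x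
  have h: "h x = t" if "t \<in> H" "x \<in> below t" for x t
    unfolding h_def using that hang_unique by (intro some_equality) blast+
  \<comment> \<open>The projection to \<open>?V\<^sub>0\<close> fixes \<open>?V\<^sub>0\<close> and
    moves points within distance \<open>r\<close> of it by at most \<open>r\<close>.\<close>
  define p where "p x = (if x \<in> ?V\<^sub>0 then x else SOME s. s \<in> ?V\<^sub>0 \<and> (s, x) \<in> near E r)" for x
  have p: "p x \<in> ?V\<^sub>0" "(p x, x) \<in> near E r" if "x \<in> ?N r ?V\<^sub>0" for x
  proof -
    have "\<exists>s. s \<in> ?V\<^sub>0 \<and> (s, x) \<in> near E r" using that unfolding nbhd_def by blast
    from someI_ex[OF this] show "p x \<in> ?V\<^sub>0" "(p x, x) \<in> near E r" unfolding p_def by auto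
  qed
  \<comment> \<open>The colours of \<open>g\<close> are copied outwards up to distance
    \<open>r\<close>. They override the inner half of the first ring of each hanging subtree; its
    outer half and the second ring keep the colours of \<open>C\<close>.\<close>
  define c where "c x = (if x \<in> ?N r ?V\<^sub>0 then g (p x) else C (h x) x)" for x
  have c_V\<^sub>0: "c x = g x" if "x \<in> ?V\<^sub>0" for x
    using that nbhd_self[of ?V\<^sub>0 E r] unfolding c_def p_def by auto
  have S_Z: "x \<in> Z" if "x \<in> ?N n S" "n \<le> 3 * r" for x n
    using nbhd_mono[OF that S] unfolding Z_def .
  have ring1: "c x" if "x \<in> ?V" "x \<in> ?N (2 * r) S" for x
  proof -
    have "x \<in> ?V\<^sub>0" using S_Z[OF that(2)] that(1) Z_V\<^sub>0 by simp
    then show ?thesis using that(2) c_V\<^sub>0 unfolding g_def by blast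
  qed
  have ring2: "\<not> c x" if "x \<in> ?V" "x \<in> ?N (3 * r) S" "x \<notin> ?N (2 * r) S" for x
  proof -
    have "x \<in> ?V\<^sub>0" using S_Z[OF that(2)] that(1) Z_V\<^sub>0 by simp
    moreover have "x \<in> ?N e (X \<rho>)" by (rule nbhd_mono[OF that(2) _ S]) (simp add: e_def)
    ultimately show ?thesis using that(3) c_V\<^sub>0 unfolding g_def by blast
  qed

  \<comment> \<open>Boundedness of the chains of the glued colouring\<close>
  have main: "bdd E r D {x \<in> ?V. x \<notin> ?N (2 * r) S \<and> c x = j}" for j
  proof -
    define P where "P = {x \<in> ?V. x \<notin> ?N (2 * r) S \<and> c x = j}"
    \<comment> \<open>\<open>far t\<close> is the part of the class beyond the first ring of
      \<open>t\<close>; \<open>AB\<close> is everything else.\<close>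
    define far where "far t = {x \<in> P. x \<in> below t \<and> x \<notin> ?N (2 * r) (adh t)}" for t
    define AB where "AB = P - \<Union>(far ` H)"
    have not_near: "x \<notin> ?N r ?V\<^sub>0" if "t \<in> H" "x \<in> below t" "x \<notin> ?N r (adh t)" for t x
    proof
      assume "x \<in> ?N r ?V\<^sub>0"
      then obtain s where "s \<in> ?V\<^sub>0" "(x, s) \<in> near E r" using sym_near unfolding nbhd_def by blast
      then show False using exit[of x s r t] V\<^sub>0_below that by blast
    qed
    have c_C: "c x = C t x" if "t \<in> H" "x \<in> below t" "x \<notin> ?N r (adh t)" for t x
      using not_near[OF that] h[OF that(1,2)] unfolding c_def by simp
    have N_mono: "x \<in> ?N n A" if "x \<in> ?N m A" "m \<le> n" for x m n A
      using nbhd_mono[OF that order_refl] .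
    \<comment> \<open>A jump between \<open>far t\<close> and the rest of the class would join a
      point at distance between \<open>2 * r\<close> and \<open>3 * r\<close> from
      \<open>adh t\<close>, coloured \<open>False\<close>, to one at distance between
      \<open>r\<close> and \<open>2 * r\<close>, which still has its ring colour
      \<open>True\<close>.\<close>
    have far_closed: "y \<in> far t" if t: "t \<in> H" and x: "x \<in> far t" and y: "y \<in> P"
      and xy: "(x, y) \<in> near E r" for t x y
    proof -
      have x': "x \<in> ?V" "x \<in> below t" "x \<notin> ?N (2 * r) (adh t)" "c x = j"
        using x unfolding far_def P_def by auto
      have y': "y \<in> ?V" "c y = j" using y unfolding P_def by auto
      have yx: "(y, x) \<in> near E r" using xy sym_near by blast
      have y_below: "y \<in> below t"
        using exit[OF xy t x'(2)] N_mono[of x r "adh t" "2 * r"] x'(3) by auto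
      have "y \<notin> ?N (2 * r) (adh t)"
      proof
        assume y2: "y \<in> ?N (2 * r) (adh t)"
        have "y \<notin> ?N r (adh t)"
          using nbhd_step[OF _ yx, of r "adh t"] x'(3) by (auto simp: mult_2)
        then have "c y = C t y" using c_C t y_below by blast
        moreover have "C t y"
          using C[OF t] V_below[OF y'(1) y_below] y2 unfolding extending_colouring_def by blast
        moreover have "x \<in> ?N (3 * r) (adh t)"
          using nbhd_step[OF y2 yx] by (simp add: algebra_simps)
        then have "\<not> C t x"
          using C[OF t] V_below[OF x'(1,2)] x'(3) unfolding extending_colouring_def by blast
        moreover have "c x = C t x"
          using c_C[OF t x'(2)] N_mono[of x r "adh t" "2 * r"] x'(3) by auto
        ultimately show False using x'(4) y'(2) by simp
      qed
      then show ?thesis using y y_below unfolding far_def by blast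
    qed
    have far: "bdd E r D (far t)" if t: "t \<in> H" for t
    proof (rule bdd_mono)
      show "bdd E r D {x \<in> \<Union>(X ` (T \<inter> desc t)). x \<notin> ?N (2 * r) (adh t) \<and> C t x = j}"
        using C[OF t] unfolding extending_colouring_def by blast
      show "far t \<subseteq> {x \<in> \<Union>(X ` (T \<inter> desc t)). x \<notin> ?N (2 * r) (adh t) \<and> C t x = j}"
      proof
        fix x assume "x \<in> far t"
        then have x: "x \<in> ?V" "x \<in> below t" "x \<notin> ?N (2 * r) (adh t)" "c x = j"
          unfolding far_def P_def by auto
        moreover have "c x = C t x"
          using c_C[OF t x(2)] N_mono[of x r "adh t" "2 * r"] x(3) by auto
        ultimately show "x \<in> {x \<in> \<Union>(X ` (T \<inter> desc t)). x \<notin> ?N (2 * r) (adh t) \<and> C t x = j}"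
          using V_below[of x t] by blast
      qed
    qed auto
    \<comment> \<open>Points within \<open>r\<close> of \<open>?V\<^sub>0\<close> are projected by
      \<open>p\<close> and bounded through \<open>g\<close>. The others lie in the outer half of a
      first ring; those of different hanging subtrees are not joined by a jump, since leaving
      \<open>below t\<close> requires being within \<open>r\<close> of \<open>adh t\<close>.
      \<open>bdd_Un\<close> combines the two.\<close>
    have AB: "bdd E r D AB"
    proof -
      let ?A = "AB \<inter> ?N r ?V\<^sub>0" and ?B = "AB - ?N r ?V\<^sub>0"
      have "bdd E r M (\<Union>((\<lambda>t. ?B \<inter> below t) ` H))"
      proof (rule bdd_Union)
        fix K assume "K \<in> (\<lambda>t. ?B \<inter> below t) ` H"
        then obtain t where t: "t \<in> H" "K = ?B \<inter> below t" by blast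
        have "finite (adh t)" "card (adh t) \<le> Suc k"
          using T(2,3)[OF H(1)[OF t(1)]] card_mono[of "X t" "adh t"] unfolding adh_def by auto
        moreover have "K \<subseteq> ?N (2 * r) (adh t)"
          using t unfolding AB_def far_def by blast
        ultimately show "bdd E r M K" unfolding M_def by (rule bdd_balls[OF sym])
        fix x y assume xy: "x \<in> K" "y \<in> \<Union>((\<lambda>t. ?B \<inter> below t) ` H)" "(x, y) \<in> near E r"
        then have "y \<in> ?B" by blast
        moreover have "y \<in> below t"
        proof (rule ccontr)
          assume "y \<notin> below t"
          then have "x \<in> ?N r (adh t)" using exit[OF xy(3) t(1)] xy(1) t(2) by blast
          then have "x \<in> ?N r ?V\<^sub>0" by (rule nbhd_mono[OF _ order_refl adh_V\<^sub>0[OF t(1)]])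
          then show False using xy(1) t(2) by blast
        qed
        ultimately show "y \<in> K" using t(2) by blast
      qed
      moreover have "?B \<subseteq> \<Union>((\<lambda>t. ?B \<inter> below t) ` H)"
      proof
        fix x assume x: "x \<in> ?B"
        then have "x \<in> ?V" "x \<notin> ?V\<^sub>0"
          using nbhd_self[of ?V\<^sub>0 E r] unfolding AB_def P_def by blast+
        from hang[OF this] x show "x \<in> \<Union>((\<lambda>t. ?B \<inter> below t) ` H)" by blast
      qed
      ultimately have B: "bdd E r M ?B" using bdd_mono[of E r M _ ?B E M r] by blast
      have A: "bdd E (M + 2 * r) (D\<^sub>2 + 2 * r) ?A"
      proof (rule bdd_proj[OF sym])
        show "bdd E (M + 2 * r + 2 * r) D\<^sub>2 {x \<in> ?V\<^sub>0. x \<notin> ?N (2 * r) S \<and> g x = j}"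
          using g[of j] unfolding r\<^sub>1_def by (simp add: algebra_simps)
        fix x assume x: "x \<in> ?A"
        then show "(p x, x) \<in> near E r" using p(2) by blast
        have x': "x \<in> ?V" "c x = j" "x \<notin> ?N (2 * r) S" "x \<in> ?N r ?V\<^sub>0"
          using x unfolding AB_def P_def by auto
        \<comment> \<open>If \<open>p x\<close> were in the ring around \<open>S\<close>, then
          \<open>x\<close> would be within \<open>3 * r\<close> of \<open>S\<close>, hence in
          \<open>?V\<^sub>0\<close> and fixed by \<open>p\<close>.\<close>
        have "p x \<notin> ?N (2 * r) S"
        proof
          assume px: "p x \<in> ?N (2 * r) S"
          have "x \<in> ?N (2 * r + r) S" using nbhd_step[OF px p(2)[OF x'(4)]] .
          then have "x \<in> ?V\<^sub>0" using Z_V\<^sub>0[OF x'(1) S_Z] by simp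
          then show False using px x'(3) unfolding p_def by simp
        qed
        then show "p x \<in> {x \<in> ?V\<^sub>0. x \<notin> ?N (2 * r) S \<and> g x = j}"
          using p(1)[OF x'(4)] x'(2,4) unfolding c_def by simp
      qed
      have "?A \<union> ?B = AB" by blast
      then show ?thesis using bdd_Un[OF B A] unfolding D_def by simp
    qed
    have "bdd E r D (\<Union>(insert AB (far ` H)))"
    proof (rule bdd_Union)
      fix K assume K: "K \<in> insert AB (far ` H)"
      then show "bdd E r D K" using AB far by blast
      fix x y assume xy: "x \<in> K" "y \<in> \<Union>(insert AB (far ` H))" "(x, y) \<in> near E r"
      have P: "x \<in> P" "y \<in> P" using K xy(1,2) unfolding AB_def far_def by blast+
      show "y \<in> K"
      proof (cases "K = AB")
        case True
        have "y \<notin> far t" if "t \<in> H" for t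
        proof
          assume "y \<in> far t"
          then have "x \<in> far t" using far_closed[OF that] P sym_near xy(3) by blast
          then show False using xy(1) True that unfolding AB_def by blast
        qed
        then show ?thesis using P True unfolding AB_def by blast
      next
        case False
        then show ?thesis using K far_closed xy(1,3) P by blast
      qed
    qed
    moreover have "\<Union>(insert AB (far ` H)) = P" unfolding AB_def far_def by blast
    ultimately show ?thesis unfolding P_def by simp
  qed
  show ?thesis
    using ring1 ring2 main unfolding extending_colouring_def by blast
qed

end

text \<open>\<open>D\<close> is chosen before the graph and its decomposition. The induction on
  \<open>k\<close> is for all scales \<open>r\<close> at once, because the step uses width
  \<open>k\<close> at the larger scale \<open>r\<^sub>1\<close>.\<close>

lemma ex_extending_colouring:
  "\<exists>D. \<forall>(E :: ('a \<times> 'a) set) (par :: 'n \<Rightarrow> 'n) dep X T \<rho> S.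
     rooted_decomposition E par dep X \<longrightarrow> rooted_decomposition.subtree par T \<rho> \<longrightarrow>
     (\<forall>t\<in>T. finite (X t) \<and> card (X t) \<le> k) \<longrightarrow> S \<subseteq> X \<rho> \<longrightarrow>
     (\<exists>c. extending_colouring E r D (\<Union>(X ` T)) S c)"
proof (induction k arbitrary: r)
  case 0
  have "extending_colouring E r 0 (\<Union>(X ` T)) S c"
    if "\<forall>t\<in>T. finite (X t) \<and> card (X t) \<le> 0"
    for E :: "('a \<times> 'a) set" and X :: "'n \<Rightarrow> 'a set" and T S c
  proof -
    have "\<Union>(X ` T) = {}" using that by auto
    then show ?thesis by (simp add: extending_colouring_def)
  qed
  then show ?case by blast
next
  case (Suc k)
  \<comment> \<open>Bound for chains within distance \<open>2 * r\<close> of one adhesion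
    set.\<close>
  define M where "M = ball_bound (Suc k) (2 * r) r"
  \<comment> \<open>Skipping an excursion into a ring takes jumps of length
    \<open>M + 2 * r\<close>, and projecting their ends to the near part adds
    \<open>2 * r\<close>.\<close>
  define r\<^sub>1 where "r\<^sub>1 = M + 4 * r"
  \<comment> \<open>A walk of length \<open>r\<^sub>1\<close> starting outside the ball of radius
    \<open>e\<close> around the root bag avoids the ball \<open>Z\<close> of radius
    \<open>3 * r\<close>.\<close>
  define e where "e = 3 * r + r\<^sub>1"
  obtain D\<^sub>1 where D\<^sub>1: "\<And>(E :: ('a \<times> 'a) set) (par :: 'n \<Rightarrow> 'n) dep X T \<rho> S.
     rooted_decomposition E par dep X \<Longrightarrow> rooted_decomposition.subtree par T \<rho> \<Longrightarrow>
     \<forall>t\<in>T. finite (X t) \<and> card (X t) \<le> k \<Longrightarrow> S \<subseteq> X \<rho> \<Longrightarrow>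
     \<exists>c. extending_colouring E r\<^sub>1 D\<^sub>1 (\<Union>(X ` T)) S c"
    using Suc.IH[of r\<^sub>1] by blast
  \<comment> \<open>The bound of \<open>bdd_Un\<close> for adding the ball of radius
    \<open>e\<close> to a class of \<open>\<chi>\<close>.\<close>
  define D\<^sub>2 where "D\<^sub>2 = ball_bound (Suc k) e (D\<^sub>1 + 2 * r\<^sub>1) + 2 * D\<^sub>1 + 2 * r\<^sub>1"
  \<comment> \<open>The bound of \<open>bdd_Un\<close> for adding the ring points to the projected
    points; the projection accounts for the first \<open>2 * r\<close>.\<close>
  define D where "D = (D\<^sub>2 + 2 * r) + 2 * M + 2 * r"
  have "\<exists>c. extending_colouring E r D (\<Union>(X ` T)) S c"
    if "rooted_decomposition E par dep X" "rooted_decomposition.subtree par T \<rho>"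
      "\<forall>t\<in>T. finite (X t) \<and> card (X t) \<le> Suc k" "S \<subseteq> X \<rho>"
    for E :: "('a \<times> 'a) set" and par :: "'n \<Rightarrow> 'n" and dep X T \<rho> S
    using that(2-)
  \<comment> \<open>The same \<open>D\<close> serves trees of every size: no jump joins the far part
    of a hanging subtree to the rest of its class, so the recursion does not enlarge the
    bound.\<close>
  proof (induction "card T" arbitrary: T \<rho> S rule: less_induct)
    case less
    interpret rooted_decomposition E par dep X by fact
    define Z where "Z = nbhd E (3 * r) (X \<rho>)"
    define T\<^sub>0 where "T\<^sub>0 = insert \<rho> {t \<in> T. X t \<inter> Z \<noteq> {}}"
    let ?E = "E \<inter> (- Z) \<times> (- Z)" and ?X = "\<lambda>t. X t \<inter> - Z"
    have T\<^sub>0: "subtree T\<^sub>0 \<rho>" unfolding T\<^sub>0_def Z_def by (rule subtree_ball[OF less.prems(1)])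
    have "finite (?X t) \<and> card (?X t) \<le> k" if t: "t \<in> T\<^sub>0" for t
    proof (cases "t = \<rho>")
      case True
      then have "?X t = {}" using nbhd_self[of "X \<rho>" E] unfolding Z_def by blast
      then show ?thesis by simp
    next
      case False
      then have "t \<in> T" "?X t \<subset> X t" using t unfolding T\<^sub>0_def by auto
      then have "finite (X t)" "card (?X t) < card (X t)" "card (X t) \<le> Suc k"
        using less.prems(2) by (auto intro: psubset_card_mono)
      then show ?thesis by simp
    qed
    \<comment> \<open>For the empty set \<open>{}\<close> both rings are empty, and the last
      condition speaks of the entire colour classes.\<close>
    then obtain \<chi> where "extending_colouring ?E r\<^sub>1 D\<^sub>1 (\<Union>(?X ` T\<^sub>0)) {} \<chi>"
      using D\<^sub>1[OF restrict T\<^sub>0, of "- Z" "{}"] by blast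
    then have "bdd ?E r\<^sub>1 D\<^sub>1 {x \<in> \<Union>(X ` T\<^sub>0) - Z. \<chi> x = j}" for j
      unfolding extending_colouring_def nbhd_def by (auto elim!: bdd_mono)
    moreover have "\<exists>c. extending_colouring E r D (\<Union>(X ` (T \<inter> desc t))) (adh t) c"
      if "t \<in> T" "t \<noteq> \<rho>" for t
      using less.hyps[OF subtree_desc(2,1)[OF less.prems(1) that], of "adh t"] less.prems(2)
      unfolding adh_def by blast
    ultimately show ?case
      using extend_step[OF less.prems(1) _ _ less.prems(3), where k = k and r = r and D\<^sub>1 = D\<^sub>1]
        less.prems(2)
      unfolding Z_def T\<^sub>0_def D_def D\<^sub>2_def e_def r\<^sub>1_def M_def by blast
  qed
  then show ?case by blast
qed

section \<open>Three colours for bounded layered tree-width\<close>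

lemma near_layer:
  assumes "\<And>x y. (x, y) \<in> E \<Longrightarrow> lay y \<le> Suc (lay x)" "(x, y) \<in> near E n"
  shows "lay y \<le> lay x + n"
  using assms(2)
proof (induction n arbitrary: x)
  case (Suc n)
  obtain z where z: "x = z \<or> (x, z) \<in> E" "(z, y) \<in> near E n"
    using near_Suc_D[OF Suc.prems] by blast
  then have "lay z \<le> Suc (lay x)" using assms(1) by auto
  then show ?case using Suc.IH[OF z(2)] by simp
qed (simp add: near_def)

text \<open>Slabs that may use colour \<open>j\<close> come in groups of at most two consecutive
  ones, separated by the slabs with index congruent to \<open>j\<close>. The quotient numbers the
  group and \<open>\<rho>\<close> is the position in it; the summand 2 keeps the subtraction
  exact.\<close>

lemma slab_decompose:
  fixes a j :: nat
  assumes "j < 3" "a mod 3 \<noteq> j"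
  obtains \<rho> where "a + 2 = 3 * ((a + 2 - j) div 3) + \<rho> + j" "\<rho> = 0 \<or> \<rho> = 1"
proof -
  define \<rho> where "\<rho> = (a + 2 - j) mod 3"
  have eq: "a + 2 = 3 * ((a + 2 - j) div 3) + \<rho> + j"
    using assms(1) mult_div_mod_eq[of 3 "a + 2 - j"] unfolding \<rho>_def by linarith
  have "\<rho> < 3" unfolding \<rho>_def by simp
  moreover have "\<rho> \<noteq> 2"
  proof
    assume "\<rho> = 2"
    then have "a = j + 3 * ((a + 2 - j) div 3)" using eq by linarith
    then have "a mod 3 = j mod 3" by (metis mod_mult_self2)
    then show False using assms by simp
  qed
  ultimately show ?thesis using that[OF eq] by linarith
qed

text \<open>Distinct slabs of one group are consecutive, hence of different parity.\<close>

lemma slab_index_eq: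
  fixes a b j :: nat
  assumes "j < 3" "a mod 3 \<noteq> j" "b mod 3 \<noteq> j" "(a + 2 - j) div 3 = (b + 2 - j) div 3"
    and "even a \<longleftrightarrow> even b"
  shows "a = b"
proof -
  obtain \<rho> \<sigma> where "a + 2 = 3 * ((b + 2 - j) div 3) + \<rho> + j" "\<rho> = 0 \<or> \<rho> = 1"
    "b + 2 = 3 * ((b + 2 - j) div 3) + \<sigma> + j" "\<sigma> = 0 \<or> \<sigma> = 1"
    using slab_decompose[OF assms(1,2)] slab_decompose[OF assms(1,3)] assms(4) by metis
  then have "a = b \<or> a = Suc b \<or> b = Suc a" by linarith
  then show ?thesis using assms(5) by auto
qed

text \<open>Different groups are separated by a slab of index congruent to \<open>j\<close>, so
  neighbouring slabs that may use \<open>j\<close> share a group.\<close>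

lemma slab_group_eq:
  fixes a b j :: nat
  assumes "j < 3" "a mod 3 \<noteq> j" "b mod 3 \<noteq> j" "a \<le> Suc b" "b \<le> Suc a"
  shows "(a + 2 - j) div 3 = (b + 2 - j) div 3"
proof -
  obtain \<rho> \<sigma> where "a + 2 = 3 * ((a + 2 - j) div 3) + \<rho> + j" "\<rho> = 0 \<or> \<rho> = 1"
    "b + 2 = 3 * ((b + 2 - j) div 3) + \<sigma> + j" "\<sigma> = 0 \<or> \<sigma> = 1"
    using slab_decompose[OF assms(1,2)] slab_decompose[OF assms(1,3)] by metis
  then show ?thesis using assms(4,5) by linarith
qed

text \<open>The slab is thickened by \<open>q\<close> layers on both sides. A bag meets at most
  \<open>s + 2 * q\<close> of these layers, which bounds the width, and walks of length
  \<open>q\<close> starting in the slab stay in the thickened slab.\<close>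

lemma ex_slab_colouring:
  fixes s q w :: nat
  shows "\<exists>D. \<forall>(E :: ('a \<times> 'a) set) (par :: 'n \<Rightarrow> 'n) dep X T \<rho> lay i.
     rooted_decomposition E par dep X \<longrightarrow> rooted_decomposition.subtree par T \<rho> \<longrightarrow>
     (\<forall>t\<in>T. finite (X t) \<and> (\<forall>l. card {x \<in> X t. lay x = l} \<le> w)) \<longrightarrow>
     (\<forall>x y. (x, y) \<in> E \<longrightarrow> lay y \<le> Suc (lay x)) \<longrightarrow>
     (\<exists>c :: 'a \<Rightarrow> bool. \<forall>j. bdd E q D {x \<in> \<Union>(X ` T). s * i \<le> lay x \<and> lay x < s * i + s \<and> c x = j})"
proof -
  obtain D where D: "\<And>(E :: ('a \<times> 'a) set) (par :: 'n \<Rightarrow> 'n) dep X T \<rho> S.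
     rooted_decomposition E par dep X \<Longrightarrow> rooted_decomposition.subtree par T \<rho> \<Longrightarrow>
     \<forall>t\<in>T. finite (X t) \<and> card (X t) \<le> (s + 2 * q) * w \<Longrightarrow> S \<subseteq> X \<rho> \<Longrightarrow>
     \<exists>c. extending_colouring E q D (\<Union>(X ` T)) S c"
    using ex_extending_colouring[where 'a = 'a and 'n = 'n and r = q and k = "(s + 2 * q) * w"] by blast
  have "\<exists>c :: 'a \<Rightarrow> bool. \<forall>j. bdd E q D {x \<in> \<Union>(X ` T). s * i \<le> lay x \<and> lay x < s * i + s \<and> c x = j}"
    if dec: "rooted_decomposition E par dep X" and T: "rooted_decomposition.subtree par T \<rho>"
      and X: "\<And>t. t \<in> T \<Longrightarrow> finite (X t)" "\<And>t l. t \<in> T \<Longrightarrow> card {x \<in> X t. lay x = l} \<le> w"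
      and lay: "\<And>x y. (x, y) \<in> E \<Longrightarrow> lay y \<le> Suc (lay x)"
    for E :: "('a \<times> 'a) set" and par :: "'n \<Rightarrow> 'n" and dep X T \<rho> lay i
  proof -
    interpret rooted_decomposition E par dep X by fact
    define Y where "Y = {x. s * i \<le> lay x + q \<and> lay x < s * i + s + q}"
    have "card (X t \<inter> Y) \<le> (s + 2 * q) * w" if t: "t \<in> T" for t
    proof -
      let ?I = "{s * i - q..<s * i + s + q}"
      have "X t \<inter> Y \<subseteq> (\<Union>l\<in>?I. {x \<in> X t. lay x = l})" unfolding Y_def by auto
      then have "card (X t \<inter> Y) \<le> card (\<Union>l\<in>?I. {x \<in> X t. lay x = l})"
        using X(1)[OF t] by (intro card_mono) auto
      also have "\<dots> \<le> (\<Sum>l\<in>?I. card {x \<in> X t. lay x = l})" by (intro card_UN_le) simp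
      also have "\<dots> \<le> card ?I * w" 
        using sum_bounded_above[of ?I "\<lambda>l. card {x \<in> X t. lay x = l}" w] X(2)[OF t] by simp
      also have "\<dots> \<le> (s + 2 * q) * w" by (intro mult_right_mono) auto
      finally show ?thesis .
    qed
    then have "\<forall>t\<in>T. finite (X t \<inter> Y) \<and> card (X t \<inter> Y) \<le> (s + 2 * q) * w" using X(1) by blast
    then obtain c where c: "extending_colouring (E \<inter> Y \<times> Y) q D (\<Union>((\<lambda>t. X t \<inter> Y) ` T)) {} c"
      using D[OF restrict[of Y] T, of "{}"] by blast
    have "bdd E q D {x \<in> \<Union>(X ` T). s * i \<le> lay x \<and> lay x < s * i + s \<and> c x = j}" for j
    proof (rule bdd_mono)
      show "bdd (E \<inter> Y \<times> Y) q D {x \<in> \<Union>((\<lambda>t. X t \<inter> Y) ` T). c x = j}"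
        using c unfolding extending_colouring_def nbhd_def by simp
      show "(x, y) \<in> near (E \<inter> Y \<times> Y) q"
        if x: "x \<in> {x \<in> \<Union>(X ` T). s * i \<le> lay x \<and> lay x < s * i + s \<and> c x = j}"
          and xy: "(x, y) \<in> near E q" for x y
      proof (rule near_restrict[OF xy])
        have "z \<in> Y" if "(x, z) \<in> near E q" for z
          using near_layer[of E lay, OF lay that] near_layer[of E lay, OF lay near_sym[OF sym that]] x
          unfolding Y_def by simp
        then show "nbhd E q {x} \<subseteq> Y" unfolding nbhd_def by blast
      qed
    qed (auto simp: Y_def)
    then show ?thesis by blast
  qed
  then show ?thesis by (intro exI[of _ D]) blast
qed

text \<open>Slabs of \<open>r + 1\<close> consecutive layers are coloured so that the \<open>i\<close>-th slab avoids the colour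
  \<open>i mod 3\<close>. A chain of one colour then stays in two consecutive slabs, and even and odd slabs use
  two different scales so that the chains in both can be combined.\<close>

lemma ex_layered_colouring:
  fixes r w :: nat
  shows "\<exists>D. \<forall>(E :: ('a \<times> 'a) set) (par :: 'n \<Rightarrow> 'n) dep X T \<rho> lay.
     rooted_decomposition E par dep X \<longrightarrow> rooted_decomposition.subtree par T \<rho> \<longrightarrow>
     (\<forall>t\<in>T. finite (X t) \<and> (\<forall>l. card {x \<in> X t. lay x = l} \<le> w)) \<longrightarrow>
     (\<forall>x y. (x, y) \<in> E \<longrightarrow> lay y \<le> Suc (lay x)) \<longrightarrow>
     (\<exists>col :: 'a \<Rightarrow> nat. (\<forall>x. col x < 3) \<and> (\<forall>j. bdd E r D {x \<in> \<Union>(X ` T). col x = j}))"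
proof -
  \<comment> \<open>A jump of length \<open>r\<close> changes the slab index by at most one; the
    successor keeps \<open>s\<close> positive when \<open>r = 0\<close>.\<close>
  define s where "s = Suc r"
  note slab = ex_slab_colouring[where 'a = 'a and 'n = 'n and s = s and w = w]
  obtain M where M: "\<And>(E :: ('a \<times> 'a) set) (par :: 'n \<Rightarrow> 'n) dep X T \<rho> lay i.
     rooted_decomposition E par dep X \<Longrightarrow> rooted_decomposition.subtree par T \<rho> \<Longrightarrow>
     (\<forall>t\<in>T. finite (X t) \<and> (\<forall>l. card {x \<in> X t. lay x = l} \<le> w)) \<Longrightarrow>
     (\<forall>x y. (x, y) \<in> E \<longrightarrow> lay y \<le> Suc (lay x)) \<Longrightarrow>
     (\<exists>c :: 'a \<Rightarrow> bool. \<forall>j. bdd E r M {x \<in> \<Union>(X ` T). s * i \<le> lay x \<and> lay x < s * i + s \<and> c x = j})"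
    using slab[of r] by blast
  obtain D where D: "\<And>(E :: ('a \<times> 'a) set) (par :: 'n \<Rightarrow> 'n) dep X T \<rho> lay i.
     rooted_decomposition E par dep X \<Longrightarrow> rooted_decomposition.subtree par T \<rho> \<Longrightarrow>
     (\<forall>t\<in>T. finite (X t) \<and> (\<forall>l. card {x \<in> X t. lay x = l} \<le> w)) \<Longrightarrow>
     (\<forall>x y. (x, y) \<in> E \<longrightarrow> lay y \<le> Suc (lay x)) \<Longrightarrow>
     (\<exists>c :: 'a \<Rightarrow> bool. \<forall>j. bdd E (M + 2 * r) D
        {x \<in> \<Union>(X ` T). s * i \<le> lay x \<and> lay x < s * i + s \<and> c x = j})"
    using slab[of "M + 2 * r"] by blast
  have "\<exists>col :: 'a \<Rightarrow> nat. (\<forall>x. col x < 3) \<and>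
      (\<forall>j. bdd E r (D + 2 * M + 2 * r) {x \<in> \<Union>(X ` T). col x = j})"
    if dec: "rooted_decomposition E par dep X" and T: "rooted_decomposition.subtree par T \<rho>"
      and X: "\<forall>t\<in>T. finite (X t) \<and> (\<forall>l. card {x \<in> X t. lay x = l} \<le> w)"
      and lay: "\<forall>x y. (x, y) \<in> E \<longrightarrow> lay y \<le> Suc (lay x)"
    for E :: "('a \<times> 'a) set" and par :: "'n \<Rightarrow> 'n" and dep X T \<rho> lay
  proof -
    interpret rooted_decomposition E par dep X by fact
    let ?V = "\<Union>(X ` T)"
    define slb where "slb x = lay x div s" for x
    have slb: "s * i \<le> lay x \<and> lay x < s * i + s \<longleftrightarrow> slb x = i" for x i
    proof -
      have "s > 0" by (simp add: s_def)
      show ?thesis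
      proof
        assume "s * i \<le> lay x \<and> lay x < s * i + s"
        then show "slb x = i" unfolding slb_def by (intro div_nat_eqI) (auto simp: algebra_simps)
      next
        assume "slb x = i"
        then show "s * i \<le> lay x \<and> lay x < s * i + s"
          using \<open>s > 0\<close> dividend_less_times_div[of s "lay x"] unfolding slb_def by auto
      qed
    qed
    have slb_conj: "s * i \<le> lay x \<and> lay x < s * i + s \<and> Q \<longleftrightarrow> slb x = i \<and> Q" for x i Q
      using slb by blast
    have "\<forall>i. \<exists>c :: 'a \<Rightarrow> bool. \<forall>j. bdd E r M {x \<in> ?V. slb x = i \<and> c x = j}"
      using M[OF dec T X lay] unfolding slb_conj by blast
    from choice[OF this] obtain C :: "nat \<Rightarrow> 'a \<Rightarrow> bool"
      where C: "\<And>i j. bdd E r M {x \<in> ?V. slb x = i \<and> C i x = j}"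
      by blast
    have "\<forall>i. \<exists>c :: 'a \<Rightarrow> bool. \<forall>j. bdd E (M + 2 * r) D {x \<in> ?V. slb x = i \<and> c x = j}"
      using D[OF dec T X lay] unfolding slb_conj by blast
    from choice[OF this] obtain C' :: "nat \<Rightarrow> 'a \<Rightarrow> bool"
      where C': "\<And>i j. bdd E (M + 2 * r) D {x \<in> ?V. slb x = i \<and> C' i x = j}"
      by blast
    define c where "c x = (if even (slb x) then C (slb x) x else C' (slb x) x)" for x
    define col where "col x = (slb x + (if c x then 1 else 2)) mod 3" for x
    have col: "col x < 3" for x unfolding col_def by simp
    have col_slb: "col x = (slb x + 1) mod 3 \<longleftrightarrow> c x" "col x \<noteq> slb x mod 3" for x
      unfolding col_def by (cases "c x"; simp only: if_True if_False; presburger)+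
    have slb_near: "slb y \<le> Suc (slb x)" if "(x, y) \<in> near E r" for x y
    proof -
      have "lay y < lay x + s" using near_layer[of E lay, OF _ that] lay by (simp add: s_def)
      then have "slb y \<le> (lay x + s) div s" unfolding slb_def by (intro div_le_mono) simp
      also have "\<dots> = Suc (slb x)" unfolding slb_def by (simp add: div_add_self2 s_def del: add_Suc_right)
      finally show ?thesis .
    qed
    have "bdd E r (D + 2 * M + 2 * r) {x \<in> ?V. col x = j}" for j
    proof (cases "j < 3")
      case j: True
      define grp where "grp x = (slb x + 2 - j) div 3" for x
      \<comment> \<open>\<open>K m\<close> collects the points of colour \<open>j\<close> in one
        group of slabs: at most one even and one odd slab, whose bounds are combined by
        \<open>bdd_Un\<close>.\<close>
      define K where "K m = {x \<in> ?V. col x = j \<and> grp x = m}" for m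
      have one: "slb x = slb y"
        if xy: "x \<in> K m" "y \<in> K m" "even (slb x) \<longleftrightarrow> even (slb y)" for x y m
      proof -
        have "slb x mod 3 \<noteq> j" "slb y mod 3 \<noteq> j" using xy col_slb(2)[of x] col_slb(2)[of y] unfolding K_def by auto
        moreover have "(slb x + 2 - j) div 3 = (slb y + 2 - j) div 3"
          using xy unfolding K_def grp_def by simp
        ultimately show ?thesis using slab_index_eq[OF j _ _ _ xy(3)] by blast
      qed
      have "bdd E r (D + 2 * M + 2 * r) (\<Union>(range K))"
      proof (rule bdd_Union)
        fix L assume "L \<in> range K"
        then obtain m where L: "L = K m" by blast
        have ev: "bdd E r M {x \<in> K m. even (slb x)}"
        proof (cases "{x \<in> K m. even (slb x)} = {}")
          case False
          then obtain y where y: "y \<in> K m" "even (slb y)" by blast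
          have "{x \<in> K m. even (slb x)} \<subseteq>
              {x \<in> ?V. slb x = slb y \<and> C (slb y) x = (j = (slb y + 1) mod 3)}"
          proof clarify
            fix x assume x: "x \<in> K m" "even (slb x)"
            then have "slb x = slb y" using one y by blast
            then show "x \<in> ?V \<and> slb x = slb y \<and> C (slb y) x = (j = (slb y + 1) mod 3)"
              using x col_slb(1)[of x] unfolding K_def c_def by auto
          qed
          then show ?thesis using bdd_mono[OF C _ order_refl order_refl] by blast
        qed (simp only: bdd_empty)
        have od: "bdd E (M + 2 * r) D {x \<in> K m. odd (slb x)}"
        proof (cases "{x \<in> K m. odd (slb x)} = {}")
          case False
          then obtain y where y: "y \<in> K m" "odd (slb y)" by blast
          have "{x \<in> K m. odd (slb x)} \<subseteq>
              {x \<in> ?V. slb x = slb y \<and> C' (slb y) x = (j = (slb y + 1) mod 3)}"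
          proof clarify
            fix x assume x: "x \<in> K m" "odd (slb x)"
            then have "slb x = slb y" using one y by blast
            then show "x \<in> ?V \<and> slb x = slb y \<and> C' (slb y) x = (j = (slb y + 1) mod 3)"
              using x col_slb(1)[of x] unfolding K_def c_def by auto
          qed
          then show ?thesis using bdd_mono[OF C' _ order_refl order_refl] by blast
        qed (simp only: bdd_empty)
        have "{x \<in> K m. odd (slb x)} \<union> {x \<in> K m. even (slb x)} = L" unfolding L by blast
        then show "bdd E r (D + 2 * M + 2 * r) L" using bdd_Un[OF ev od] by simp
        fix x y assume xy: "x \<in> L" "y \<in> \<Union>(range K)" "(x, y) \<in> near E r"
        have "slb y \<le> Suc (slb x)" "slb x \<le> Suc (slb y)"
          using slb_near xy(3) near_sym[OF sym xy(3)] by blast+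
        moreover have "slb x mod 3 \<noteq> j" "slb y mod 3 \<noteq> j"
          using xy(1,2) col_slb(2)[of x] col_slb(2)[of y] L unfolding K_def by auto
        ultimately have "grp x = grp y" unfolding grp_def by (intro slab_group_eq[OF j])
        then show "y \<in> L" using xy(1,2) unfolding L K_def by auto
      qed
      moreover have "\<Union>(range K) = {x \<in> ?V. col x = j}" unfolding K_def by auto
      ultimately show ?thesis by simp
    next
      case False
      then have "{x \<in> ?V. col x = j} = {}" using col by auto
      then show ?thesis by (simp only: bdd_empty)
    qed
    then show ?thesis using col by blast
  qed
  then show ?thesis by (intro exI[of _ "D + 2 * M + 2 * r"]) blast
qed

section \<open>Distances and trees in the graph library\<close>

context pair_wf_digraph
begin

text \<open>When \<open>x\<close> already occurs on the path from \<open>z\<close>, the part of the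
  path from \<open>x\<close> onwards is used instead of prepending the arc.\<close>

lemma near_apath:
  assumes "(x, y) \<in> near (parcs G) n" "y \<in> pverts G"
  shows "\<exists>p. apath x p y \<and> length p \<le> n"
  using assms(1)
proof (induction n arbitrary: x)
  case 0
  then show ?case using assms(2) by (auto simp: near_def apath_Nil_iff)
next
  case (Suc n)
  obtain z where z: "x = z \<or> (x, z) \<in> parcs G" "(z, y) \<in> near (parcs G) n"
    using near_Suc_D[OF Suc.prems] by blast
  obtain p where p: "apath z p y" "length p \<le> n" using Suc.IH[OF z(2)] by blast
  show ?case
  proof (cases "x \<in> set (pawalk_verts z p)")
    case True
    then obtain q q' where q: "p = q @ q'" "awalk z q x" "awalk x q' y"
      using awalk_decomp[OF awalkI_apath[OF p(1)] True] by blast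
    have "last (pawalk_verts z q) = x" using q(2) by (elim awalkE)
    then have "apath x q' y" using p(1) unfolding q(1) apath_append_iff by simp
    then show ?thesis using p(2) q(1) by auto
  next
    case False
    then have "(x, z) \<in> parcs G" using z(1) p(1) hd_in_awalk_verts(2) by auto
    then have "apath x ((x, z) # p) y" using p(1) False by (simp add: apath_Cons_iff)
    then show ?thesis using p(2) by force
  qed
qed

lemma apath_near: "apath x p y \<Longrightarrow> (x, y) \<in> near (parcs G) (length p)"
proof (induction p arbitrary: x)
  case (Cons a p)
  then have "(x, snd a) \<in> parcs G" "(snd a, y) \<in> near (parcs G) (length p)"
    by (auto simp: apath_Cons_iff)
  then show ?case using near_Suc_I[of x "snd a"] by simp
qed (simp add: apath_Nil_iff)

lemma graph_dist_le:
  assumes "(x, y) \<in> near (parcs G) n" "y \<in> pverts G"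
  shows "graph_dist G x y \<le> ereal (real n)"
proof -
  obtain p where "apath x p y" "length p \<le> n" using near_apath[OF assms] by blast
  then show ?thesis unfolding graph_dist_def by (intro INF_lower2[of p]) auto
qed

text \<open>Path lengths are integers, so each exceeds the floor of \<open>r\<close> by at least
  one. Without any path the infimum is infinite.\<close>

lemma graph_dist_gt:
  assumes "(x, y) \<notin> near (parcs G) (nat \<lfloor>r\<rfloor>)"
  shows "graph_dist G x y > ereal r"
proof -
  have "nat \<lfloor>r\<rfloor> < length p" if "apath x p y" for p
    using apath_near[OF that] near_mono assms by (meson not_le)
  then have "ereal (real (Suc (nat \<lfloor>r\<rfloor>))) \<le> graph_dist G x y"
    unfolding graph_dist_def by (intro INF_greatest) (simp add: Suc_leI del: of_nat_Suc)
  moreover have "r < real (Suc (nat \<lfloor>r\<rfloor>))" by linarith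
  then have "ereal r < ereal (real (Suc (nat \<lfloor>r\<rfloor>)))" by simp
  ultimately show ?thesis by (rule less_le_trans[rotated])
qed

end

lemma connected_rtrancl:
  assumes "Digraph_Component.connected H" "u \<in> verts H" "v \<in> verts H"
  shows "(u, v) \<in> (\<Union>e\<in>arcs H. {(tail H e, head H e), (head H e, tail H e)})\<^sup>*"
proof -
  have "u \<rightarrow>\<^sup>*\<^bsub>with_proj (mk_symmetric H)\<^esub> v"
    using assms unfolding Digraph_Component.connected_def strongly_connected_def
    by (simp add: mk_symmetric_def)
  then have "(u, v) \<in> (arcs_ends (with_proj (mk_symmetric H)))\<^sup>*"
    unfolding reachable_def by (rule rtrancl_on_rtranclI)
  then show ?thesis by (simp add: mk_symmetric_def)
qed

text \<open>An arbitrary node is the root, \<open>dep\<close> is the distance to it, and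
  \<open>par\<close> picks a neighbour closer to it. An arc between two nodes neither of which is
  the parent of the other would close a cycle with a path of parent arcs.\<close>

lemma ex_rooted_tree:
  assumes "undirected_tree T"
  obtains par dep \<rho> where "rooted_tree par dep" "\<rho> \<in> pverts T"
    "\<And>t. t \<in> pverts T \<Longrightarrow> t \<noteq> \<rho> \<Longrightarrow> par t \<in> pverts T \<and> par t \<noteq> t"
    "\<And>u v. (u, v) \<in> parcs T \<Longrightarrow> u = par v \<or> v = par u"
proof -
  interpret pair_graph T using assms by (simp add: undirected_tree_def)
  have sym: "Relation.sym (parcs T)" 
    using pair_sym_arcs by (auto simp: symmetric_def)
  have conn: "Digraph_Component.connected (with_proj T)"
    using assms by (simp add: undirected_tree_def)
  then obtain \<rho> where \<rho>: "\<rho> \<in> pverts T"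
    unfolding Digraph_Component.connected_def strongly_connected_def
    by (auto simp: mk_symmetric_def)
  have "\<exists>n. (t, \<rho>) \<in> parcs T ^^ n" if "t \<in> pverts T" for t
  proof -
    have "(t, \<rho>) \<in> (\<Union>e\<in>parcs T. {e, (snd e, fst e)})\<^sup>*"
      using connected_rtrancl[OF conn] that \<rho> by simp
    moreover have "(\<Union>e\<in>parcs T. {e, (snd e, fst e)}) \<subseteq> parcs T" using sym by (auto dest: symD)
    ultimately have "(t, \<rho>) \<in> (parcs T)\<^sup>*" using rtrancl_mono by blast
    then show ?thesis by (rule rtrancl_imp_relpow)
  qed
  define dep where "dep t = (LEAST n. (t, \<rho>) \<in> parcs T ^^ n)" for t
  have dep: "(t, \<rho>) \<in> parcs T ^^ dep t" if "t \<in> pverts T" for t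
    unfolding dep_def by (rule LeastI_ex) (fact \<open>\<And>t. t \<in> pverts T \<Longrightarrow> _\<close>[OF that])
  have ex_par: "\<exists>u. (t, u) \<in> parcs T \<and> dep u < dep t" if t: "t \<in> pverts T" "t \<noteq> \<rho>" for t
  proof -
    obtain n where n: "dep t = Suc n" using dep[OF t(1)] t(2) by (cases "dep t") auto
    then obtain u where u: "(t, u) \<in> parcs T" "(u, \<rho>) \<in> parcs T ^^ n"
      using dep[OF t(1)] relpow_Suc_D2 by metis
    have "dep u \<le> n" unfolding dep_def using u(2) by (rule Least_le)
    then show ?thesis using u(1) n by auto
  qed
  \<comment> \<open>The root and all values outside the tree become fixed points.\<close>
  define par where "par t = (if t \<in> pverts T \<and> t \<noteq> \<rho> then SOME u. (t, u) \<in> parcs T \<and> dep u < dep t else t)" for t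
  have par: "(t, par t) \<in> parcs T \<and> dep (par t) < dep t" if "t \<in> pverts T" "t \<noteq> \<rho>" for t
    using someI_ex[OF ex_par[OF that]] that unfolding par_def by simp
  have tree: "rooted_tree par dep"
    using par by unfold_locales (auto simp: par_def)
  define Q where "Q = \<lparr>pverts = pverts T, parcs = {(a, b) \<in> parcs T. b = par a \<or> a = par b}\<rparr>"
  interpret Q: pair_wf_digraph Q
    by unfold_locales (auto simp: Q_def wellformed')
  have Q_root: "(t, \<rho>) \<in> (parcs Q)\<^sup>*" if "t \<in> pverts T" for t
    using that
  proof (induction "dep t" arbitrary: t rule: less_induct)
    case less
    show ?case
    proof (cases "t = \<rho>")
      case False
      have p: "(t, par t) \<in> parcs T" "dep (par t) < dep t" using par[OF less.prems False] by auto
      then have "(t, par t) \<in> parcs Q" by (simp add: Q_def)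
      then show ?thesis using less.hyps[OF p(2)] in_arcsD2[OF p(1)] by (meson converse_rtrancl_into_rtrancl)
    qed simp
  qed
  have Q_sym: "Relation.sym (parcs Q)" using sym by (auto simp: Q_def sym_def)
  have arc: "u = par v \<or> v = par u" if uv: "(u, v) \<in> parcs T" for u v
  proof (rule ccontr)
    assume neg: "\<not> (u = par v \<or> v = par u)"
    have "(v, \<rho>) \<in> (parcs Q)\<^sup>*" "(\<rho>, u) \<in> (parcs Q)\<^sup>*"
      using Q_root in_arcsD1[OF uv] in_arcsD2[OF uv] sym_rtrancl[OF Q_sym] by (auto dest: symD)
    then have "(v, u) \<in> (parcs Q)\<^sup>*" by (rule rtrancl_trans)
    then have "(v, u) \<in> ((parcs Q)\<^sup>=)\<^sup>*" by simp
    then obtain n where "(v, u) \<in> near (parcs Q) n"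
      unfolding near_def using rtrancl_imp_relpow by blast
    moreover have "u \<in> pverts Q" using in_arcsD1[OF uv] by (simp add: Q_def)
    ultimately obtain p where p: "Q.apath v p u" using Q.near_apath by blast
    have "subgraph Q T"
      unfolding subgraph_def compatible_def
      using Q.wf_digraph_axioms wf_digraph_axioms by (auto simp: Q_def)
    then have p': "apath v p u" using subgraph_apath_imp_apath p by blast
    have "u \<noteq> v" using pair_no_loops[OF uv] by simp
    then have "p \<noteq> []" using p by (auto simp: Q.apath_Nil_iff)
    moreover have "p \<noteq> [e]" for e
    proof
      assume "p = [e]"
      then have "(v, u) \<in> parcs Q" using p by (cases e) (auto simp: Q.apath_Cons_iff Q.apath_Nil_iff)
      then show False using neg by (auto simp: Q_def)
    qed
    \<comment> \<open>The path from \<open>v\<close> to \<open>u\<close> has at least two arcs, as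
      the direct arc is not in \<open>Q\<close>; the arc \<open>(u, v)\<close> is the third.\<close>
    ultimately have len: "length ((u, v) # p) \<ge> 3"
      by (cases p; cases "tl p") auto
    have "cycle ((u, v) # p)"
      unfolding cycle_def using p' uv by (auto simp: apath_def awalk_Cons_iff intro!: exI[of _ u])
    then show False using assms len unfolding undirected_tree_def by blast
  qed
  show ?thesis
  proof (rule that[OF tree \<rho> _ arc])
    show "par t \<in> pverts T \<and> par t \<noteq> t" if "t \<in> pverts T" "t \<noteq> \<rho>" for t
      using par[OF that] in_arcsD2 by auto
  qed
qed

lemma ex_rooted_decomposition:
  assumes G: "pair_graph G" and dec: "tree_decomposition G T bag"
  obtains par dep \<rho> where
    "rooted_decomposition (parcs G) par dep (\<lambda>t. if t \<in> pverts T then bag t else {})"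
    "rooted_decomposition.subtree par (pverts T) \<rho>"
proof -
  interpret G: pair_graph G by fact
  interpret T: pair_graph T using dec by (simp add: tree_decomposition_def undirected_tree_def)
  have "undirected_tree T" using dec by (simp add: tree_decomposition_def)
  then obtain par dep \<rho> where tree: "rooted_tree par dep" and \<rho>: "\<rho> \<in> pverts T"
    and par: "\<And>t. t \<in> pverts T \<Longrightarrow> t \<noteq> \<rho> \<Longrightarrow> par t \<in> pverts T \<and> par t \<noteq> t"
    and arc: "\<And>u v. (u, v) \<in> parcs T \<Longrightarrow> u = par v \<or> v = par u"
    using ex_rooted_tree by metis
  interpret rooted_tree par dep by fact
  \<comment> \<open>The conditions of the locale range over all values of the node type, so values
    that are not nodes of \<open>T\<close> get an empty bag.\<close>
  let ?X = "\<lambda>t. if t \<in> pverts T then bag t else {}"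
  have "\<exists>m. \<forall>t. x \<in> ?X t \<longrightarrow> t \<noteq> m \<longrightarrow> par t \<noteq> t \<and> x \<in> ?X (par t)" for x
  proof (cases "\<exists>t\<in>pverts T. x \<in> bag t")
    case True
    define N where "N = {t \<in> pverts T. x \<in> bag t}"
    obtain m where m: "m \<in> N" "\<And>t. t \<in> N \<Longrightarrow> dep m \<le> dep t"
      using True ex_has_least_nat[of "\<lambda>t. t \<in> N" _ dep] unfolding N_def by auto
    have "x \<in> pverts G" using True dec by (auto simp: tree_decomposition_def)
    then have conn: "Digraph_Component.connected (with_proj T \<restriction> N)"
      using dec by (simp add: tree_decomposition_def N_def)
    have "par t \<noteq> t \<and> par t \<in> N" if t: "t \<in> N" "t \<noteq> m" for t
    proof -
      have "m \<notin> desc t"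
      proof
        assume "m \<in> desc t"
        then have "dep t < dep m" using desc_dep_strict t(2) by blast
        then show False using m(2)[OF t(1)] by simp
      qed
      let ?R = "\<Union>e\<in>{e \<in> parcs T. fst e \<in> N \<and> snd e \<in> N}. {e, (snd e, fst e)}"
      have "(t, m) \<in> ?R\<^sup>*"
        using connected_rtrancl[OF conn, of t m] t(1) m(1) by (simp add: induce_subgraph_def)
      \<comment> \<open>The walk from \<open>t\<close> to \<open>m\<close> stays among the nodes
        whose bags contain \<open>x\<close> and has to leave the subtree of \<open>t\<close>; the
        only arc that leaves it goes from \<open>t\<close> to \<open>par t\<close>.\<close>
      moreover have "par t \<noteq> t \<and> par t \<in> N" if "(a, m) \<in> ?R\<^sup>*" "a \<in> desc t" for a
        using that
      proof (induction rule: converse_rtrancl_induct)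
        case base
        then show ?case using \<open>m \<notin> desc t\<close> by blast
      next
        case (step a b)
        show ?case
        proof (cases "b \<in> desc t")
          case False
          have ab: "(a, b) \<in> parcs T \<or> (b, a) \<in> parcs T" "b \<in> N" using step.hyps(1) by auto
          then have "a = par b \<or> b = par a" "a \<noteq> b" using arc T.pair_no_loops by fastforce+
          then have "b = par a" using False desc_parI step.prems by blast
          moreover have "a = t" using desc_par[OF step.prems] False \<open>b = par a\<close> by blast
          ultimately show ?thesis using ab(2) \<open>a \<noteq> b\<close> \<open>b = par a\<close> by simp
        qed (use step.IH in blast)
      qed
      ultimately show ?thesis by simp
    qed
    then have "\<forall>t. x \<in> ?X t \<longrightarrow> t \<noteq> m \<longrightarrow> par t \<noteq> t \<and> x \<in> ?X (par t)"
      unfolding N_def by auto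
    then show ?thesis by blast
  qed auto
  moreover have "Relation.sym (parcs G)" using G.pair_sym_arcs by (auto simp: symmetric_def)
  moreover have "\<exists>t. x \<in> ?X t \<and> y \<in> ?X t" if "(x, y) \<in> parcs G" for x y
    using that dec unfolding tree_decomposition_def by fastforce
  ultimately interpret D: rooted_decomposition "parcs G" par dep ?X
    by unfold_locales blast+
  have "D.subtree (pverts T) \<rho>"
    unfolding D.subtree_def using \<rho> par T.pair_finite_verts by blast
  then show ?thesis by (rule that[OF D.rooted_decomposition_axioms])
qed

section \<open>Asymptotic dimension\<close>

lemma ex_layer_function:
  assumes "layering G L"
  obtains lay where "\<And>x. x \<in> pverts G \<Longrightarrow> x \<in> L (lay x)"
    "\<And>x y. (x, y) \<in> parcs G \<Longrightarrow> lay y \<le> Suc (lay x)"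
proof -
  define lay where "lay x = (THE i. x \<in> L i)" for x
  have lay: "lay x = i" if "x \<in> L i" for x i
    unfolding lay_def using that assms by (intro the_equality) (auto simp: layering_def)
  show ?thesis
  proof (rule that[of lay])
    show "x \<in> L (lay x)" if "x \<in> pverts G" for x
      using that assms lay unfolding layering_def by blast
    show "lay y \<le> Suc (lay x)" if "(x, y) \<in> parcs G" for x y
    proof -
      have "\<forall>e\<in>parcs G. \<exists>i. fst e \<in> L i \<union> L (Suc i) \<and> snd e \<in> L i \<union> L (Suc i)"
        using assms unfolding layering_def case_prod_unfold by (elim conjE)
      from bspec[OF this that] obtain i where "x \<in> L i \<union> L (Suc i)" "y \<in> L i \<union> L (Suc i)"
        unfolding fst_conv snd_conv by (elim exE conjE)
      then show ?thesis using lay[of x i] lay[of x "Suc i"] lay[of y i] lay[of y "Suc i"] by auto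
    qed
  qed
qed

lemma layered_treewidth_le:
  assumes "layered_treewidth G \<le> enat w"
  obtains T :: "nat pair_pre_digraph" and bag L where "tree_decomposition G T bag" "layering G L"
    "\<And>t i. t \<in> pverts T \<Longrightarrow> card (bag t \<inter> L i) \<le> w"
proof -
  let ?W = "{enat w | w. \<exists>(T :: nat pair_pre_digraph) bag L.
    tree_decomposition G T bag \<and> layering G L \<and> (\<forall>t\<in>pverts T. \<forall>i. card (bag t \<inter> L i) \<le> w)}"
  have "?W \<noteq> {}"
  proof
    assume "?W = {}"
    then have "layered_treewidth G = \<infinity>"
      unfolding layered_treewidth_def by (simp only: Inf_enat_def) simp
    then show False using assms by simp
  qed
  then have "Inf ?W \<in> ?W" by (metis (no_types, lifting) ex_in_conv wellorder_InfI)
  then obtain w' and T :: "nat pair_pre_digraph" and bag L where w': "Inf ?W = enat w'"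
    and *: "tree_decomposition G T bag" "layering G L"
      "\<And>t i. t \<in> pverts T \<Longrightarrow> card (bag t \<inter> L i) \<le> w'"
    by blast
  have "w' \<le> w" using assms w' unfolding layered_treewidth_def by simp
  then show ?thesis using that[OF *(1,2)] *(3) order_trans by blast
qed

text \<open>The sets of each collection are the chain components of a colour class at scale
  \<open>r\<close>.\<close>

lemma bdd_colouring_covers:
  fixes G :: "'a pair_pre_digraph" and col :: "'a \<Rightarrow> nat"
  assumes G: "pair_graph G" and col: "\<And>x. col x < Suc n"
    and bdd: "\<And>j. bdd (parcs G) (nat \<lfloor>r\<rfloor>) D {x \<in> pverts G. col x = j}"
  shows "\<exists>\<U> :: nat \<Rightarrow> 'a set set.
        (\<forall>i\<in>{1..n+1}. \<forall>U\<in>\<U> i. U \<subseteq> pverts G) \<and>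
        (\<Union>i\<in>{1..n+1}. \<Union>(\<U> i)) = pverts G \<and>
        (\<forall>i\<in>{1..n+1}.
           (\<forall>U\<in>\<U> i. \<forall>U'\<in>\<U> i. U \<noteq> U' \<longrightarrow>
              (\<forall>x\<in>U. \<forall>x'\<in>U'. graph_dist G x x' > ereal r)) \<and>
           (\<forall>U\<in>\<U> i. \<forall>x\<in>U. \<forall>x'\<in>U. graph_dist G x x' \<le> ereal (real D)))"
proof -
  interpret pair_graph G by fact
  \<comment> \<open>Colours start at 0 and collections at 1; \<open>P 0\<close> is empty.\<close>
  define P where "P i = {x \<in> pverts G. Suc (col x) = i}" for i
  define R where "R i = near (parcs G) (nat \<lfloor>r\<rfloor>) \<inter> P i \<times> P i" for i
  define \<U> where "\<U> i = (\<lambda>x. (R i)\<^sup>* `` {x}) ` P i" for i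
  have "sym (parcs G)" using pair_sym_arcs by (auto simp: symmetric_def)
  then have "(y, x) \<in> R i" if "(x, y) \<in> R i" for x y i
    using that near_sym[of "parcs G" x y] unfolding R_def by blast
  then have "sym (R i)" for i by (rule symI)
  then have sym: "sym ((R i)\<^sup>*)" for i by (rule sym_rtrancl)
  have UP: "y \<in> P i" if "x \<in> P i" "(x, y) \<in> (R i)\<^sup>*" for x y i
    using that(2,1) by induction (auto simp: R_def)
  have R_near: "(x, y) \<in> near (parcs G) D" if "(x, y) \<in> (R i)\<^sup>*" for x y i
  proof (cases i)
    case 0
    then have "R i = {}" by (simp add: R_def P_def)
    then show ?thesis using that by simp
  next
    case (Suc j)
    then have "P i = {x \<in> pverts G. col x = j}" by (auto simp: P_def)
    then show ?thesis using bdd_near[OF bdd[of j]] that by (simp add: R_def)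
  qed
  show ?thesis
  proof (intro exI[of _ \<U>] conjI ballI impI)
    show "U \<subseteq> pverts G" if "U \<in> \<U> i" for U i
      using that UP unfolding \<U>_def P_def by blast
    show "(\<Union>i\<in>{1..n+1}. \<Union>(\<U> i)) = pverts G"
    proof
      show "(\<Union>i\<in>{1..n+1}. \<Union>(\<U> i)) \<subseteq> pverts G" using UP unfolding \<U>_def P_def by blast
      show "pverts G \<subseteq> (\<Union>i\<in>{1..n+1}. \<Union>(\<U> i))"
      proof
        fix x assume "x \<in> pverts G"
        then have "x \<in> P (Suc (col x))" by (simp add: P_def)
        then have "x \<in> \<Union>(\<U> (Suc (col x)))" unfolding \<U>_def by blast
        moreover have "Suc (col x) \<in> {1..n+1}" using col[of x] by simp
        ultimately show "x \<in> (\<Union>i\<in>{1..n+1}. \<Union>(\<U> i))" by blast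
      qed
    qed
    show "graph_dist G x x' > ereal r"
      if U: "U \<in> \<U> i" "U' \<in> \<U> i" "U \<noteq> U'" "x \<in> U" "x' \<in> U'" for U U' x x' i
    proof (rule graph_dist_gt, rule)
      assume near: "(x, x') \<in> near (parcs G) (nat \<lfloor>r\<rfloor>)"
      obtain y y' where y: "y \<in> P i" "U = (R i)\<^sup>* `` {y}" "y' \<in> P i" "U' = (R i)\<^sup>* `` {y'}"
        using U(1,2) unfolding \<U>_def by blast
      have "x \<in> P i" "x' \<in> P i" using UP y U(4,5) by blast+
      then have "(x, x') \<in> (R i)\<^sup>*" using near unfolding R_def by blast
      moreover have "(y, x) \<in> (R i)\<^sup>*" "(x', y') \<in> (R i)\<^sup>*" using y U(4,5) symD[OF sym] by auto
      ultimately have yy': "(y, y') \<in> (R i)\<^sup>*" by (meson rtrancl_trans)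
      then have "(y', y) \<in> (R i)\<^sup>*" by (rule symD[OF sym])
      then have "U = U'" using yy' rtrancl_trans unfolding y(2,4) by fast
      then show False using U(3) by simp
    qed
    show "graph_dist G x x' \<le> ereal (real D)" if U: "U \<in> \<U> i" "x \<in> U" "x' \<in> U" for U x x' i
    proof -
      obtain y where y: "y \<in> P i" "(y, x) \<in> (R i)\<^sup>*" "(y, x') \<in> (R i)\<^sup>*"
        using U unfolding \<U>_def by blast
      then have "(x, x') \<in> (R i)\<^sup>*" using symD[OF sym] rtrancl_trans by metis
      moreover have "x' \<in> pverts G" using UP[OF y(1,3)] by (simp add: P_def)
      ultimately show ?thesis using graph_dist_le R_near by blast
    qed
  qed
qed

theorem theorem6p3:
  fixes w :: nat
  assumes "w > 0"
  shows "asymptotic_dimension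
           {G :: 'a pair_pre_digraph. pair_graph G \<and> layered_treewidth G \<le> enat w} \<le> 2"
proof -
  let ?F = "{G :: 'a pair_pre_digraph. pair_graph G \<and> layered_treewidth G \<le> enat w}"
  \<comment> \<open>The bound depends only on the scale \<open>q\<close> and is common to all graphs
    of the class, which makes it a control function.\<close>
  have "\<exists>D. \<forall>G\<in>?F. \<exists>col :: 'a \<Rightarrow> nat. (\<forall>x. col x < 3) \<and>
      (\<forall>j. bdd (parcs G) q D {x \<in> pverts G. col x = j})" for q
  proof -
    obtain D where D: "\<And>(E :: ('a \<times> 'a) set) (par :: nat \<Rightarrow> nat) dep X T \<rho> lay.
       rooted_decomposition E par dep X \<Longrightarrow> rooted_decomposition.subtree par T \<rho> \<Longrightarrow>
       (\<forall>t\<in>T. finite (X t) \<and> (\<forall>l. card {x \<in> X t. lay x = l} \<le> w)) \<Longrightarrow>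
       (\<forall>x y. (x, y) \<in> E \<longrightarrow> lay y \<le> Suc (lay x)) \<Longrightarrow>
       (\<exists>col :: 'a \<Rightarrow> nat. (\<forall>x. col x < 3) \<and> (\<forall>j. bdd E q D {x \<in> \<Union>(X ` T). col x = j}))"
      using ex_layered_colouring[where 'a = 'a and 'n = nat and r = q and w = w] by blast
    have "\<exists>col :: 'a \<Rightarrow> nat. (\<forall>x. col x < 3) \<and>
        (\<forall>j. bdd (parcs G) q D {x \<in> pverts G. col x = j})"
      if G: "pair_graph G" "layered_treewidth G \<le> enat w" for G
    proof -
      interpret pair_graph G by fact
      obtain T :: "nat pair_pre_digraph" and bag L where T: "tree_decomposition G T bag"
        and L: "layering G L" and w: "\<And>t i. t \<in> pverts T \<Longrightarrow> card (bag t \<inter> L i) \<le> w"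
        by (rule layered_treewidth_le[OF G(2)]) blast
      obtain lay where lay: "\<And>x. x \<in> pverts G \<Longrightarrow> x \<in> L (lay x)"
          "\<And>x y. (x, y) \<in> parcs G \<Longrightarrow> lay y \<le> Suc (lay x)"
        by (rule ex_layer_function[OF L]) blast
      let ?X = "\<lambda>t. if t \<in> pverts T then bag t else {}"
      obtain par dep \<rho> where dec: "rooted_decomposition (parcs G) par dep ?X"
        "rooted_decomposition.subtree par (pverts T) \<rho>"
        by (rule ex_rooted_decomposition[OF G(1) T])
      have V: "(\<Union>t\<in>pverts T. bag t) = pverts G" using T by (simp add: tree_decomposition_def)
      have "finite (?X t) \<and> (\<forall>l. card {x \<in> ?X t. lay x = l} \<le> w)" if t: "t \<in> pverts T" for t
      proof -
        have bag: "bag t \<subseteq> pverts G" using V t by blast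
        then have fin: "finite (bag t)" using pair_finite_verts finite_subset by blast
        have "card {x \<in> bag t. lay x = l} \<le> card (bag t \<inter> L l)" for l
          using fin bag lay(1) by (intro card_mono) auto
        then show ?thesis using w[OF t] fin t order_trans by fastforce
      qed
      then have "\<exists>col :: 'a \<Rightarrow> nat. (\<forall>x. col x < 3) \<and>
          (\<forall>j. bdd (parcs G) q D {x \<in> \<Union>(?X ` pverts T). col x = j})"
        using lay(2) by (intro D[OF dec, of lay]) blast+
      moreover have "\<Union>(?X ` pverts T) = pverts G" using V by simp
      ultimately show ?thesis by (simp only:)
    qed
    then show ?thesis by blast
  qed
  then have "\<forall>q. \<exists>D. \<forall>G\<in>?F. \<exists>col :: 'a \<Rightarrow> nat. (\<forall>x. col x < 3) \<and>
      (\<forall>j. bdd (parcs G) q D {x \<in> pverts G. col x = j})"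
    by (intro allI)
  from choice[OF this] obtain D where D: "\<And>q G. G \<in> ?F \<Longrightarrow> \<exists>col :: 'a \<Rightarrow> nat. (\<forall>x. col x < 3) \<and>
      (\<forall>j. bdd (parcs G) q (D q) {x \<in> pverts G. col x = j})"
    by blast
  \<comment> \<open>The successor makes the control function positive.\<close>
  have "control_function 2 (\<lambda>r. real (Suc (D (nat \<lfloor>r\<rfloor>)))) ?F"
    unfolding control_function_def
  proof (intro conjI ballI allI impI)
    fix G :: "'a pair_pre_digraph" and r :: real assume G: "G \<in> ?F"
    obtain col :: "'a \<Rightarrow> nat" where col: "\<And>x. col x < Suc 2"
      "\<And>j. bdd (parcs G) (nat \<lfloor>r\<rfloor>) (D (nat \<lfloor>r\<rfloor>)) {x \<in> pverts G. col x = j}"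
      using D[OF G, of "nat \<lfloor>r\<rfloor>"] by auto
    have "bdd (parcs G) (nat \<lfloor>r\<rfloor>) (Suc (D (nat \<lfloor>r\<rfloor>))) {x \<in> pverts G. col x = j}" for j
      by (rule bdd_mono[OF col(2) order_refl order_refl]) auto
    with G col(1) show "\<exists>\<U> :: nat \<Rightarrow> 'a set set.
        (\<forall>i\<in>{1..2+1}. \<forall>U\<in>\<U> i. U \<subseteq> pverts G) \<and>
        (\<Union>i\<in>{1..2+1}. \<Union>(\<U> i)) = pverts G \<and>
        (\<forall>i\<in>{1..2+1}.
           (\<forall>U\<in>\<U> i. \<forall>U'\<in>\<U> i. U \<noteq> U' \<longrightarrow>
              (\<forall>x\<in>U. \<forall>x'\<in>U'. graph_dist G x x' > ereal r)) \<and>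
           (\<forall>U\<in>\<U> i. \<forall>x\<in>U. \<forall>x'\<in>U. graph_dist G x x' \<le> ereal (real (Suc (D (nat \<lfloor>r\<rfloor>))))))"
      by (intro bdd_colouring_covers) auto
  qed simp
  then have "asymptotic_dimension ?F \<le> enat 2"
    unfolding asymptotic_dimension_def by (intro Inf_lower) blast
  then show ?thesis by (simp add: numeral_eq_enat)
qed

end
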